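(* Let $n\ge 2$ be an integer, $0<s\le\frac n4$ with $s\notin\mathbb{Z}$, and let $f\in L^{\frac{2n}{n+4s}}(\mathbb{R}^n)$. Suppose that there exist $\beta\in\mathbb{S}^{n-1}$ and a nonempty open set $U$ in $\mathbb{R}^n$ such that $f=0$ in $U$ and $$(\mathcal{C}^{2s-1}f)(u,\beta,\psi)=0\quad\text{for all }(u,\psi)\in U\times(0,\pi).$$ Then $f\equiv 0$ in $\mathbb{R}^n$.
   Context: For $u\in\mathbb{R}^n$, $\beta\in\mathbb{S}^{n-1}$, $\psi\in(0,\pi)$, let $\mathfrak{C}(u,\beta,\psi)=\{x\in\mathbb{R}^n: (x-u)\cdot\beta=|x-u|\cos\psi\}$ be the cone with vertex $u$, central axis $\beta$ and opening angle $\psi$. For $-1<k<n-1$ the $k$-th weighted cone transform is $$(\mathcal{C}^kf)(u,\beta,\psi)=\int_{\mathfrak{C}(u,\beta,\psi)}f(x)\,|x-u|^{k-n+2}\,dS_x,$$ where $dS$ is the surface measure on the cone. It is defined in the first place for Schwartz functions $f$; for the $f$ in the claim, $\mathcal{C}^{2s-1}f$ is understood by the same integral formula. *)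

theory Defs
  imports "HOL-Analysis.Analysis"
begin

(* Membership of a function in the Lebesgue space of exponent p > 0 on the whole space. The
   function is a representative: equality in the Lebesgue space is equality almost everywhere. *)
definition in_Lp :: "real \<Rightarrow> ('a::euclidean_space \<Rightarrow> complex) \<Rightarrow> bool" where
  "in_Lp p f \<longleftrightarrow>
     f \<in> borel_measurable lebesgue \<and> integrable lebesgue (\<lambda>x. norm (f x) powr p)"

definition perp :: "'a::euclidean_space \<Rightarrow> 'a \<Rightarrow> 'a" where
  "perp \<beta> x = x - (x \<bullet> \<beta>) *\<^sub>R \<beta>"

(* For a unit vector \<beta>, the Lebesgue measure of the hyperplane through 0 orthogonal to \<beta>, as a
   measure on the whole space. The hyperplane is not a type of its own; by Fubini, the area of a
   subset A of it is the volume of the cylinder over A of height 1 in direction \<beta>. *)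
definition hyperplane_lborel :: "'a::euclidean_space \<Rightarrow> 'a measure" where
  "hyperplane_lborel \<beta> =
     distr (restrict_space lborel {x. 0 \<le> x \<bullet> \<beta> \<and> x \<bullet> \<beta> \<le> 1}) borel (perp \<beta>)"

(* The gradient, with an unspecified value at points where g is not differentiable. *)
definition grad :: "('a::euclidean_space \<Rightarrow> real) \<Rightarrow> 'a \<Rightarrow> 'a" where
  "grad g y = (THE D. GDERIV g y :> D)"

(* Surface measure dS = sqrt (1 + |grad g|^2) dy of the graph over that hyperplane of a function
   g, i.e. of {x. x \<bullet> \<beta> = g x}. Here g is defined on the whole space and must be constant in
   direction \<beta>, so that grad g is the gradient within the hyperplane. *)
definition graph_surface_measure ::
    "'a::euclidean_space \<Rightarrow> ('a \<Rightarrow> real) \<Rightarrow> 'a measure" where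
  "graph_surface_measure \<beta> g =
     distr (density (hyperplane_lborel \<beta>) (\<lambda>y. ennreal (sqrt (1 + (norm (grad g y))\<^sup>2)))) borel
       (\<lambda>y. y + g y *\<^sub>R \<beta>)"

definition circular_cone :: "'a::euclidean_space \<Rightarrow> 'a \<Rightarrow> real \<Rightarrow> 'a set" where
  "circular_cone u \<beta> \<psi> = {x. (x - u) \<bullet> \<beta> = norm (x - u) * cos \<psi>}"

definition cone_height :: "'a::euclidean_space \<Rightarrow> 'a \<Rightarrow> real \<Rightarrow> 'a \<Rightarrow> real" where
  "cone_height u \<beta> \<psi> y = u \<bullet> \<beta> + norm (perp \<beta> (y - u)) * cot \<psi>"

(* The completion makes functions that are only Lebesgue measurable in the whole space measurable
   on almost all cones. *)
definition cone_surface_measure :: "'a::euclidean_space \<Rightarrow> 'a \<Rightarrow> real \<Rightarrow> 'a measure" where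
  "cone_surface_measure u \<beta> \<psi> =
     completion (graph_surface_measure \<beta> (cone_height u \<beta> \<psi>))"

(* As for every Bochner integral, the value is 0 if the integrand is not integrable on the cone. *)
definition cone_transform ::
    "real \<Rightarrow> ('a::euclidean_space \<Rightarrow> complex) \<Rightarrow> 'a \<Rightarrow> 'a \<Rightarrow> real \<Rightarrow> complex" where
  "cone_transform k f u \<beta> \<psi> =
     (LINT x:circular_cone u \<beta> \<psi>|cone_surface_measure u \<beta> \<psi>.
        norm (x - u) powr (k - real DIM('a) + 2) *\<^sub>R f x)"

(* The following lemmas justify cone_surface_measure: the cone is the graph of cone_height, which
   is constant in direction \<beta> and has surface element dy / sin \<psi> away from the axis. *)
lemma norm_eq_perp:
  assumes "norm \<beta> = 1"
  shows "(norm x)\<^sup>2 = (norm (perp \<beta> x))\<^sup>2 + (x \<bullet> \<beta>)\<^sup>2"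
proof -
  have "\<beta> \<bullet> \<beta> = 1" using assms by (simp add: dot_square_norm)
  then show ?thesis
    unfolding perp_def power2_norm_eq_inner
    by (simp add: inner_diff_left inner_diff_right inner_commute[of \<beta> x] power2_eq_square)
qed

lemma circular_cone_eq_graph:
  assumes "norm \<beta> = 1" and "0 < \<psi>" and "\<psi> < pi"
  shows "circular_cone u \<beta> \<psi> = {x. x \<bullet> \<beta> = cone_height u \<beta> \<psi> x}"
proof -
  have s: "sin \<psi> > 0" using assms by (simp add: sin_gt_zero)
  have "(x \<bullet> \<beta> = norm x * cos \<psi>) = (x \<bullet> \<beta> = norm (perp \<beta> x) * cot \<psi>)" for x
  proof
    assume h: "x \<bullet> \<beta> = norm x * cos \<psi>"
    have "(norm (perp \<beta> x))\<^sup>2 = (norm x)\<^sup>2 * (1 - (cos \<psi>)\<^sup>2)"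
      using norm_eq_perp[OF assms(1), of x] h by (simp add: power_mult_distrib algebra_simps)
    then have "(norm (perp \<beta> x))\<^sup>2 = (norm x * sin \<psi>)\<^sup>2"
      by (simp add: sin_squared_eq power_mult_distrib)
    then have "norm (perp \<beta> x) = norm x * sin \<psi>"
      using s by (simp add: power2_eq_iff_nonneg)
    then show "x \<bullet> \<beta> = norm (perp \<beta> x) * cot \<psi>"
      using h s by (simp add: cot_def)
  next
    assume h: "x \<bullet> \<beta> = norm (perp \<beta> x) * cot \<psi>"
    have c: "1 + (cot \<psi>)\<^sup>2 = 1 / (sin \<psi>)\<^sup>2"
      using s by (simp add: cot_def power_divide add_divide_eq_iff)
    have "(norm x)\<^sup>2 = (norm (perp \<beta> x))\<^sup>2 * (1 + (cot \<psi>)\<^sup>2)"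
      using norm_eq_perp[OF assms(1), of x] h by (simp add: algebra_simps power_mult_distrib)
    then have "(norm x * sin \<psi>)\<^sup>2 = (norm (perp \<beta> x))\<^sup>2"
      unfolding c using s by (simp add: power_mult_distrib)
    then have "norm (perp \<beta> x) = norm x * sin \<psi>"
      using s by (simp add: power2_eq_iff_nonneg)
    then show "x \<bullet> \<beta> = norm x * cos \<psi>"
      using h s by (auto simp: cot_def)
  qed
  from this[of "_ - u"] show ?thesis
    by (auto simp: circular_cone_def cone_height_def inner_diff_left algebra_simps)
qed

lemma cone_height_shift:
  assumes "norm \<beta> = 1"
  shows "cone_height u \<beta> \<psi> (y + t *\<^sub>R \<beta>) = cone_height u \<beta> \<psi> y"
proof -
  have "\<beta> \<bullet> \<beta> = 1" using assms by (simp add: dot_square_norm)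
  then have "perp \<beta> (y + t *\<^sub>R \<beta> - u) = perp \<beta> (y - u)"
    by (simp add: perp_def inner_diff_left inner_add_left algebra_simps)
  then show ?thesis by (simp add: cone_height_def)
qed

lemma cone_surface_element:
  assumes "norm \<beta> = 1" and "0 < \<psi>" and "\<psi> < pi" and y: "perp \<beta> (y - u) \<noteq> 0"
  shows "sqrt (1 + (norm (grad (cone_height u \<beta> \<psi>) y))\<^sup>2) = 1 / sin \<psi>"
proof -
  have s: "sin \<psi> > 0" using assms by (simp add: sin_gt_zero)
  have bb: "\<beta> \<bullet> \<beta> = 1" using assms by (simp add: dot_square_norm)
  let ?w = "perp \<beta> (y - u)"
  let ?D = "(cot \<psi> / norm ?w) *\<^sub>R ?w"
  have wb: "?w \<bullet> \<beta> = 0" by (simp add: perp_def inner_diff_left bb)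
  have d1: "((\<lambda>y. perp \<beta> (y - u)) has_derivative perp \<beta>) (at y)"
    unfolding perp_def by (auto intro!: derivative_eq_intros)
  have "(norm has_derivative (\<lambda>h. h \<bullet> sgn ?w)) (at ?w)"
    using GDERIV_norm[OF y] by (simp add: gderiv_def)
  from has_derivative_compose[OF d1 this]
  have d2: "((\<lambda>y. norm (perp \<beta> (y - u))) has_derivative (\<lambda>h. perp \<beta> h \<bullet> sgn ?w)) (at y)" .
  have pd: "perp \<beta> h \<bullet> sgn ?w = h \<bullet> sgn ?w" for h
  proof -
    have "\<beta> \<bullet> sgn ?w = 0" using wb by (simp add: sgn_div_norm inner_commute)
    then show ?thesis by (simp add: perp_def[of _ h] inner_diff_left)
  qed
  have D: "GDERIV (cone_height u \<beta> \<psi>) y :> ?D"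
    unfolding gderiv_def cone_height_def
    using d2[unfolded pd]
    by (auto intro!: derivative_eq_intros simp: sgn_div_norm divide_inverse mult_ac)
  have "grad (cone_height u \<beta> \<psi>) y = ?D"
    unfolding grad_def
  proof (rule the_equality)
    fix E assume "GDERIV (cone_height u \<beta> \<psi>) y :> E"
    then have "(\<lambda>h. h \<bullet> E) = (\<lambda>h. h \<bullet> ?D)"
      using D unfolding gderiv_def by (blast intro: has_derivative_unique)
    then show "E = ?D" by (metis vector_eq_ldot)
  qed (rule D)
  then have "(norm (grad (cone_height u \<beta> \<psi>) y))\<^sup>2 = (cot \<psi>)\<^sup>2"
    using y by (simp add: power_divide)
  moreover have "1 + (cot \<psi>)\<^sup>2 = (1 / sin \<psi>)\<^sup>2"
    using s by (simp add: cot_def power_divide field_simps)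
  ultimately show ?thesis using s by (simp add: real_sqrt_divide)
qed

end

theory Submission
  imports Defs
begin

text \<open>
  The cones with vertex \<open>u\<close> and axis \<open>\<beta>\<close> sweep out the space, and integrating the weighted cone transform of order
  \<open>2 * s - 1\<close> over all opening angles gives, by Fubini's theorem, the Riesz potential
  \<open>\<integral> f x * norm (x - u) powr (2 * s - n) dx\<close> (lemma \<open>riesz_potential_eq_0_if_cone_transform_eq_0\<close>). So both \<open>f\<close> and its
  Riesz potential of order \<open>2 * s\<close> vanish on \<open>U\<close>, and the claim becomes the unique continuation property of the
  Riesz potential, which has a proof by moments.

  Let the origin be in \<open>U\<close>. Since \<open>f\<close> vanishes near the origin, the potential may be differentiated there under the integral
  sign, and all derivatives vanish: \<open>f\<close> is annihilated by all derivatives of \<open>norm x powr a\<close>, where \<open>a = 2 * s - n\<close>.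
  Powers of the Laplacian turn \<open>norm x powr a\<close> into \<open>norm x powr (a - 2 * m)\<close>, up to a constant that is not zero because \<open>s\<close>
  is not an integer (\<open>annihilates_powr\<close>). Further derivatives in a direction \<open>w\<close> give the kernels
  \<open>(x \<bullet> w) ^ N * norm x powr (a - 2 * N)\<close> (\<open>annihilates_riesz_kernel\<close>). In terms of the inverted point
  \<open>y = x /\<^sub>R (norm x)\<^sup>2\<close> these are \<open>norm x powr a * (y \<bullet> w) ^ N\<close>. Inversion maps the support of \<open>f\<close> into a bounded set, so the
  complex measure with density \<open>norm x powr a *\<^sub>R f x\<close>, pushed forward by inversion, has compact support and all its
  moments vanish. By the theorem of Stone and Weierstrass it is zero (\<open>AE_zero_if_left_inverse\<close>).

  The complex measure is finite because \<open>norm x powr a\<close> is, off a ball, in the Lebesgue space dual to that of \<open>f\<close>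
  (\<open>integrable_powr_mult_outside_ball\<close>).
\<close>

section \<open>Integration over all opening angles\<close>

text \<open>
  Fubini's theorem and push-forwards of measures are applied to a Borel representative of the function,
  which exists because real and imaginary part have one.
\<close>

lemma completion_ex_borel_measurable_complex:
  fixes f :: "'a \<Rightarrow> complex"
  assumes [measurable]: "f \<in> borel_measurable (completion M)"
  obtains g where "g \<in> borel_measurable M" and "AE x in M. f x = g x"
proof -
  have "(\<lambda>x. Re (f x)) \<in> borel_measurable (completion M)" and "(\<lambda>x. Im (f x)) \<in> borel_measurable (completion M)"
    by measurable
  from this[THEN completion_ex_borel_measurable_real] obtain g h
    where [measurable]: "g \<in> borel_measurable M" "h \<in> borel_measurable M"
      and gh: "AE x in M. Re (f x) = g x" "AE x in M. Im (f x) = h x"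
    by blast
  show thesis
  proof
    show "(\<lambda>x. complex_of_real (g x) + \<i> * complex_of_real (h x)) \<in> borel_measurable M" by measurable
    show "AE x in M. f x = complex_of_real (g x) + \<i> * complex_of_real (h x)"
      using gh by eventually_elim (auto simp: complex_eq_iff)
  qed
qed

lemma borel_measurable_completion_AE_eq:
  fixes f h :: "'a \<Rightarrow> 'b::topological_space"
  assumes h: "h \<in> borel_measurable M" and eq: "AE x in completion M. f x = h x"
  shows "f \<in> borel_measurable (completion M)"
proof (rule measurableI)
  fix A :: "'b set" assume "A \<in> sets borel"
  then have "h -` A \<inter> space M \<in> sets (completion M)"
    using h by (intro sets_completionI_sets measurable_sets)
  then show "f -` A \<inter> space (completion M) \<in> sets (completion M)"
    by (rule completion.in_sets_AE[rotated]) (use eq AE_space in \<open>auto elim: eventually_elim2\<close>)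
qed simp

lemma perp_measurable[measurable]: "perp (\<beta>::'a::euclidean_space) \<in> borel_measurable borel"
  unfolding perp_def by measurable

lemma perp_diff: "perp \<beta> (x - y) = perp \<beta> x - perp \<beta> y"
  by (simp add: perp_def inner_diff_left algebra_simps)

lemma perp_perp: "norm \<beta> = 1 \<Longrightarrow> perp \<beta> (perp \<beta> x) = perp \<beta> x"
  by (simp add: perp_def inner_diff_left dot_square_norm)

lemma perp_inner: "norm \<beta> = 1 \<Longrightarrow> perp \<beta> x \<bullet> \<beta> = 0"
  by (simp add: perp_def inner_diff_left dot_square_norm)

text \<open>
  In dimension at least 2 the line through \<open>u\<close> in direction \<open>\<beta>\<close> lies in a hyperplane, hence is a null set. Its
  points project to that of the vertex, where the gradient of the cone height need not exist.
\<close>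

lemma AE_off_axis:
  fixes \<beta> u :: "'a::euclidean_space"
  assumes dim: "DIM('a) \<ge> 2" and \<beta>: "norm \<beta> = 1"
  shows "AE x in lborel. perp \<beta> (x - u) \<noteq> 0"
proof -
  have "\<beta> \<noteq> 0" using \<beta> by auto
  then obtain S where S: "\<beta> \<in> S" "0 \<notin> S" "pairwise orthogonal S" "card S = DIM('a)"
    by (rule vector_in_orthogonal_basis)
  have "S \<noteq> {\<beta>}" using S(4) dim by auto
  then obtain \<gamma> where \<gamma>: "\<gamma> \<in> S" "\<gamma> \<noteq> \<beta>" using S(1) by blast
  then have \<gamma>0: "\<gamma> \<noteq> 0" and orth: "\<gamma> \<bullet> \<beta> = 0"
    using S by (auto simp: pairwise_def orthogonal_def)
  have "negligible {x. \<gamma> \<bullet> x = \<gamma> \<bullet> u}"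
    using \<gamma>0 by (intro negligible_hyperplane) auto
  then have "{x. \<gamma> \<bullet> x = \<gamma> \<bullet> u} \<in> null_sets lebesgue"
    by (simp add: negligible_iff_null_sets)
  from AE_not_in[OF this] have "AE x in lborel. \<gamma> \<bullet> x \<noteq> \<gamma> \<bullet> u"
    by (simp add: AE_completion_iff)
  then show ?thesis
  proof eventually_elim
    case (elim x)
    show ?case
    proof
      assume "perp \<beta> (x - u) = 0"
      then have "x - u = ((x - u) \<bullet> \<beta>) *\<^sub>R \<beta>" by (simp add: perp_def)
      then have "\<gamma> \<bullet> (x - u) = 0" by (metis inner_scaleR_right mult_zero_right orth)
      then show False using elim by (simp add: inner_diff_right)
    qed
  qed
qed

lemma nn_integral_translation:
  fixes F :: "'a::euclidean_space \<Rightarrow> ennreal"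
  assumes [measurable]: "F \<in> borel_measurable borel"
  shows "(\<integral>\<^sup>+x. F (c + x) \<partial>lborel) = (\<integral>\<^sup>+x. F x \<partial>lborel)"
proof -
  have "(\<integral>\<^sup>+x. F x \<partial>lborel) = (\<integral>\<^sup>+x. F x \<partial>distr lborel borel ((+) c))"
    by (simp only: lborel_distr_plus)
  also have "\<dots> = (\<integral>\<^sup>+x. F (c + x) \<partial>lborel)"
    by (rule nn_integral_distr) measurable
  finally show ?thesis ..
qed

text \<open>
  The strip over which the area of the hyperplane orthogonal to \<open>\<beta>\<close> is measured.
\<close>

definition slab :: "'a::euclidean_space \<Rightarrow> 'a set" where
  "slab \<beta> = {x. 0 \<le> x \<bullet> \<beta> \<and> x \<bullet> \<beta> \<le> 1}"

lemma slab_measurable[measurable]: "slab \<beta> \<in> sets borel"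
  unfolding slab_def by measurable

text \<open>
  Integration over the hyperplane orthogonal to \<open>\<beta>\<close> and then along the lines in direction \<open>\<beta>\<close> is integration
  over the space. As the area of the hyperplane is defined through the strip of height 1, this needs no
  choice of an orthonormal basis: after an exchange of integrals and a translation, a point \<open>x\<close> is counted
  with the length of the set of those \<open>t\<close> that move \<open>x - t \<beta>\<close> into the strip, and this length is 1.
\<close>

lemma nn_integral_lines:
  fixes F :: "'a::euclidean_space \<Rightarrow> ennreal"
  assumes [measurable]: "F \<in> borel_measurable borel" and \<beta>: "norm \<beta> = 1"
  shows "(\<integral>\<^sup>+x. indicator (slab \<beta>) x * (\<integral>\<^sup>+t. F (x + t *\<^sub>R \<beta>) \<partial>lborel) \<partial>lborel) = (\<integral>\<^sup>+x. F x \<partial>lborel)"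
proof -
  have \<beta>\<beta>: "\<beta> \<bullet> \<beta> = 1" using \<beta> by (simp add: dot_square_norm)
  have "(\<integral>\<^sup>+x. indicator (slab \<beta>) x * (\<integral>\<^sup>+t. F (x + t *\<^sub>R \<beta>) \<partial>lborel) \<partial>lborel) =
      (\<integral>\<^sup>+x. (\<integral>\<^sup>+t. indicator (slab \<beta>) x * F (x + t *\<^sub>R \<beta>) \<partial>(lborel :: real measure)) \<partial>lborel)"
    by (intro nn_integral_cong nn_integral_cmult[symmetric]) measurable
  also have "\<dots> = (\<integral>\<^sup>+t. (\<integral>\<^sup>+x. indicator (slab \<beta>) x * F (x + t *\<^sub>R \<beta>) \<partial>lborel) \<partial>(lborel :: real measure))"
    by (rule lborel_pair.Fubini'[symmetric]) measurable
  also have "\<dots> = (\<integral>\<^sup>+t. (\<integral>\<^sup>+x. indicator (slab \<beta>) (x - t *\<^sub>R \<beta>) * F x \<partial>lborel) \<partial>(lborel :: real measure))"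
  proof (rule nn_integral_cong)
    fix t :: real
    show "(\<integral>\<^sup>+x. indicator (slab \<beta>) x * F (x + t *\<^sub>R \<beta>) \<partial>lborel) =
        (\<integral>\<^sup>+x. indicator (slab \<beta>) (x - t *\<^sub>R \<beta>) * F x \<partial>lborel)"
      by (subst nn_integral_translation[symmetric, where c = "t *\<^sub>R \<beta>"]) (measurable, simp add: add.commute)
  qed
  also have "\<dots> = (\<integral>\<^sup>+x. (\<integral>\<^sup>+t. indicator (slab \<beta>) (x - t *\<^sub>R \<beta>) * F x \<partial>(lborel :: real measure)) \<partial>lborel)"
    by (rule lborel_pair.Fubini') measurable
  also have "\<dots> = (\<integral>\<^sup>+x. F x \<partial>lborel)"
  proof (rule nn_integral_cong)
    fix x
    have "indicator (slab \<beta>) (x - t *\<^sub>R \<beta>) = (indicator {x \<bullet> \<beta> - 1 .. x \<bullet> \<beta>} t :: ennreal)" for t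
      by (auto simp: slab_def indicator_def inner_diff_left \<beta>\<beta>)
    then show "(\<integral>\<^sup>+t. indicator (slab \<beta>) (x - t *\<^sub>R \<beta>) * F x \<partial>(lborel :: real measure)) = F x"
      by (simp add: nn_integral_multc)
  qed
  finally show ?thesis .
qed

text \<open>
  The point of the cone with \<open>cot \<psi> = c\<close> that has the same projection along \<open>\<beta>\<close> as \<open>x\<close>. Using \<open>c\<close> instead of \<open>\<psi>\<close>
  as parameter makes the height above the vertex linear in the parameter.
\<close>

definition cone_point :: "'a::euclidean_space \<Rightarrow> 'a \<Rightarrow> real \<Rightarrow> 'a \<Rightarrow> 'a" where
  "cone_point u \<beta> c x = perp \<beta> x + (u \<bullet> \<beta> + norm (perp \<beta> (x - u)) * c) *\<^sub>R \<beta>"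

text \<open>
  The Jacobian of \<open>cone_point\<close>, which is the distance to the axis because the height above the vertex is this
  distance times \<open>c\<close>. The indicator function selects one strip, over which each line in direction \<open>\<beta>\<close> counts once.
\<close>

definition axis_weight :: "'a::euclidean_space \<Rightarrow> 'a \<Rightarrow> 'a \<Rightarrow> real" where
  "axis_weight u \<beta> x = indicator (slab \<beta>) x * norm (perp \<beta> (x - u))"

lemma axis_weight_measurable[measurable]: "axis_weight u \<beta> \<in> borel_measurable borel"
  unfolding axis_weight_def by measurable

lemma axis_weight_nonneg: "axis_weight u \<beta> x \<ge> 0"
  by (simp add: axis_weight_def)

lemma cone_point_measurable[measurable (raw)]:
  assumes [measurable]: "c \<in> borel_measurable M" "X \<in> borel_measurable M"
  shows "(\<lambda>z. cone_point u \<beta> (c z) (X z)) \<in> borel_measurable M"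
  unfolding cone_point_def by measurable

text \<open>
  The cones with vertex \<open>u\<close> and axis \<open>\<beta>\<close> sweep out the space. On each line in direction \<open>\<beta>\<close> other than the axis, the
  affine substitution \<open>t = u \<bullet> \<beta> - x \<bullet> \<beta> + \<rho> c\<close>, with \<open>\<rho>\<close> the distance to the axis, turns the integral over the
  line into an integral over \<open>c\<close>.
\<close>

lemma nn_integral_cones:
  fixes F :: "'a::euclidean_space \<Rightarrow> ennreal"
  assumes [measurable]: "F \<in> borel_measurable borel"
    and dim: "DIM('a) \<ge> 2" and \<beta>: "norm \<beta> = 1"
  shows "(\<integral>\<^sup>+x. (\<integral>\<^sup>+c. ennreal (axis_weight u \<beta> x) * F (cone_point u \<beta> c x) \<partial>lborel) \<partial>lborel) = (\<integral>\<^sup>+x. F x \<partial>lborel)"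
proof -
  have inner: "(\<integral>\<^sup>+c. ennreal (axis_weight u \<beta> x) * F (cone_point u \<beta> c x) \<partial>lborel) =
      indicator (slab \<beta>) x * (\<integral>\<^sup>+t. F (x + t *\<^sub>R \<beta>) \<partial>lborel)"
    if "perp \<beta> (x - u) \<noteq> 0" for x
  proof -
    let ?\<rho> = "norm (perp \<beta> (x - u))"
    have "(\<integral>\<^sup>+t. F (x + t *\<^sub>R \<beta>) \<partial>lborel) =
        ennreal ?\<rho> * (\<integral>\<^sup>+c. F (x + (u \<bullet> \<beta> - x \<bullet> \<beta> + ?\<rho> * c) *\<^sub>R \<beta>) \<partial>lborel)"
      by (subst nn_integral_real_affine[where c = ?\<rho> and t = "u \<bullet> \<beta> - x \<bullet> \<beta>"]) (use that in auto)
    also have "\<dots> = ennreal ?\<rho> * (\<integral>\<^sup>+c. F (cone_point u \<beta> c x) \<partial>lborel)"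
      by (simp add: cone_point_def perp_def[of \<beta> x] algebra_simps)
    finally show ?thesis
      by (subst nn_integral_cmult) (auto simp: axis_weight_def indicator_def)
  qed
  have "(\<integral>\<^sup>+x. (\<integral>\<^sup>+c. ennreal (axis_weight u \<beta> x) * F (cone_point u \<beta> c x) \<partial>lborel) \<partial>lborel) =
      (\<integral>\<^sup>+x. indicator (slab \<beta>) x * (\<integral>\<^sup>+t. F (x + t *\<^sub>R \<beta>) \<partial>lborel) \<partial>lborel)"
    using AE_off_axis[OF dim \<beta>, of u] by (intro nn_integral_cong_AE) (auto elim!: eventually_mono simp: inner)
  also have "\<dots> = (\<integral>\<^sup>+x. F x \<partial>lborel)"
    by (rule nn_integral_lines[OF _ \<beta>]) measurable
  finally show ?thesis .
qed

lemma lborel_eq_cones: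
  fixes u \<beta> :: "'a::euclidean_space"
  assumes dim: "DIM('a) \<ge> 2" and \<beta>: "norm \<beta> = 1"
  shows "distr (density (lborel \<Otimes>\<^sub>M lborel) (\<lambda>(x, c). ennreal (axis_weight u \<beta> x))) borel
     (\<lambda>(x, c). cone_point u \<beta> c x) = lborel" (is "?M = _")
proof (rule measure_eqI)
  fix A assume "A \<in> sets ?M"
  then have [measurable]: "A \<in> sets borel" by simp
  have "emeasure ?M A = (\<integral>\<^sup>+x. indicator A x \<partial>?M)"
    by simp
  also have "\<dots> = (\<integral>\<^sup>+(x, c). ennreal (axis_weight u \<beta> x) * indicator A (cone_point u \<beta> c x) \<partial>(lborel \<Otimes>\<^sub>M lborel))"
    by (subst nn_integral_distr, measurable, subst nn_integral_density) (auto simp: case_prod_beta')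
  also have "\<dots> = (\<integral>\<^sup>+x. (\<integral>\<^sup>+c. ennreal (axis_weight u \<beta> x) * indicator A (cone_point u \<beta> c x) \<partial>lborel) \<partial>lborel)"
    by (subst lborel.nn_integral_fst[symmetric]) auto
  also have "\<dots> = emeasure lborel A"
    by (subst nn_integral_cones[OF _ dim \<beta>]) auto
  finally show "emeasure ?M A = emeasure lborel A" .
qed simp

text \<open>
  For an arbitrary \<open>f\<close>, since a density built from the gradient of the cone height takes an unspecified value
  on the axis.
\<close>

lemma density_cong_AE:
  assumes "AE x in M. f x = g x"
  shows "density M f = density M g"
proof -
  have "(\<integral>\<^sup>+x. f x * indicator A x \<partial>M) = (\<integral>\<^sup>+x. g x * indicator A x \<partial>M)" for A
    using assms by (intro nn_integral_cong_AE) (auto elim!: eventually_mono)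
  then show ?thesis by (simp add: density_def)
qed

text \<open>
  Off the axis the surface element is constant, so that the surface measure is a multiple of the push-forward
  of the area of the hyperplane.
\<close>

lemma graph_surface_measure_cone:
  fixes u \<beta> :: "'a::euclidean_space"
  assumes dim: "DIM('a) \<ge> 2" and \<beta>: "norm \<beta> = 1" and \<psi>: "0 < \<psi>" "\<psi> < pi"
  shows "graph_surface_measure \<beta> (cone_height u \<beta> \<psi>) =
    distr (density (restrict_space lborel (slab \<beta>)) (\<lambda>_. ennreal (1 / sin \<psi>))) borel (cone_point u \<beta> (cot \<psi>))"
proof -
  let ?S = "restrict_space lborel (slab \<beta>)"
  have H: "hyperplane_lborel \<beta> = distr ?S borel (perp \<beta>)"
    by (simp add: hyperplane_lborel_def slab_def)
  have pm: "perp \<beta> \<in> ?S \<rightarrow>\<^sub>M borel"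
    by (intro measurable_restrict_space1) simp
  have "AE y in hyperplane_lborel \<beta>. perp \<beta> (y - u) \<noteq> 0"
    unfolding H
  proof (subst AE_distr_iff[OF pm])
    show "AE x in ?S. perp \<beta> (perp \<beta> x - u) \<noteq> 0"
      using AE_off_axis[OF dim \<beta>, of u]
      by (subst AE_restrict_space_iff) (auto elim!: eventually_mono simp: perp_diff perp_perp \<beta>)
  qed measurable
  then have "AE y in hyperplane_lborel \<beta>. ennreal (sqrt (1 + (norm (grad (cone_height u \<beta> \<psi>) y))\<^sup>2)) = ennreal (1 / sin \<psi>)"
    by eventually_elim (subst cone_surface_element[OF \<beta> \<psi>], auto)
  then have "density (hyperplane_lborel \<beta>) (\<lambda>y. ennreal (sqrt (1 + (norm (grad (cone_height u \<beta> \<psi>) y))\<^sup>2))) =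
      density (hyperplane_lborel \<beta>) (\<lambda>_. ennreal (1 / sin \<psi>))"
    by (rule density_cong_AE)
  also have "\<dots> = distr (density ?S (\<lambda>_. ennreal (1 / sin \<psi>))) borel (perp \<beta>)"
    unfolding H by (rule density_distr[OF _ pm]) simp
  finally have "graph_surface_measure \<beta> (cone_height u \<beta> \<psi>) =
      distr (distr (density ?S (\<lambda>_. ennreal (1 / sin \<psi>))) borel (perp \<beta>)) borel
        (\<lambda>y. y + cone_height u \<beta> \<psi> y *\<^sub>R \<beta>)"
    by (simp add: graph_surface_measure_def)
  also have "\<dots> = distr (density ?S (\<lambda>_. ennreal (1 / sin \<psi>))) borel
      ((\<lambda>y. y + cone_height u \<beta> \<psi> y *\<^sub>R \<beta>) \<circ> perp \<beta>)"
    using pm by (intro distr_distr) (auto simp: cone_height_def)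
  also have "(\<lambda>y. y + cone_height u \<beta> \<psi> y *\<^sub>R \<beta>) \<circ> perp \<beta> = cone_point u \<beta> (cot \<psi>)"
    by (auto simp: cone_height_def cone_point_def perp_diff perp_perp[OF \<beta>])
  finally show ?thesis .
qed

lemma norm_cone_point:
  assumes \<beta>: "norm \<beta> = 1" and \<psi>: "0 < \<psi>" "\<psi> < pi"
  shows "norm (cone_point u \<beta> (cot \<psi>) x - u) = norm (perp \<beta> (x - u)) / sin \<psi>"
proof -
  let ?p = "perp \<beta> (x - u)" and ?c = "cone_point u \<beta> (cot \<psi>) x - u"
  have s: "sin \<psi> > 0" using \<psi> by (simp add: sin_gt_zero)
  have \<beta>\<beta>: "\<beta> \<bullet> \<beta> = 1" using \<beta> by (simp add: dot_square_norm)
  have c: "?c = ?p + (norm ?p * cot \<psi>) *\<^sub>R \<beta>"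
    by (simp add: cone_point_def perp_diff perp_def[of \<beta> u] algebra_simps)
  have "?c \<bullet> \<beta> = norm ?p * cot \<psi>"
    unfolding c by (simp add: inner_add_left perp_inner \<beta> \<beta>\<beta>)
  moreover have "perp \<beta> ?c = ?p"
    unfolding c by (simp add: perp_def inner_add_left inner_diff_left \<beta>\<beta> algebra_simps)
  ultimately have "(norm ?c)\<^sup>2 = (norm ?p)\<^sup>2 * (1 + (cot \<psi>)\<^sup>2)"
    using norm_eq_perp[OF \<beta>, of ?c] by (simp add: power_mult_distrib algebra_simps)
  also have "1 + (cot \<psi>)\<^sup>2 = (1 / sin \<psi>)\<^sup>2"
    using s by (simp add: cot_def power_divide field_simps)
  finally have "(norm ?c)\<^sup>2 = (norm ?p / sin \<psi>)\<^sup>2"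
    by (simp add: power_divide)
  then show ?thesis
    using s by (simp add: power2_eq_iff_nonneg)
qed

lemma cone_point_in_cone:
  assumes \<beta>: "norm \<beta> = 1" and \<psi>: "0 < \<psi>" "\<psi> < pi"
  shows "cone_point u \<beta> (cot \<psi>) x \<in> circular_cone u \<beta> \<psi>"
proof -
  have \<beta>\<beta>: "\<beta> \<bullet> \<beta> = 1" using \<beta> by (simp add: dot_square_norm)
  have "cone_point u \<beta> (cot \<psi>) x \<bullet> \<beta> = u \<bullet> \<beta> + norm (perp \<beta> (x - u)) * cot \<psi>"
    by (simp add: cone_point_def inner_add_left perp_inner \<beta> \<beta>\<beta>)
  moreover have "perp \<beta> (cone_point u \<beta> (cot \<psi>) x - u) = perp \<beta> (x - u)"
    by (simp add: cone_point_def perp_def inner_add_left inner_diff_left \<beta>\<beta> algebra_simps)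
  ultimately show ?thesis
    unfolding circular_cone_eq_graph[OF \<beta> \<psi>] by (simp add: cone_height_def)
qed

text \<open>
  The distance to the vertex is the distance to the axis divided by \<open>sin \<psi>\<close>. Splitting off one power of it
  therefore produces the Jacobian of the parametrisation by cones and one factor \<open>1 / sin \<psi>\<close>; the other one is the
  surface element. What remains is the kernel of the Riesz potential of order \<open>k + 1\<close>.
\<close>

lemma cone_transform_borel:
  fixes g :: "'a::euclidean_space \<Rightarrow> complex"
  assumes [measurable]: "g \<in> borel_measurable borel"
    and dim: "DIM('a) \<ge> 2" and \<beta>: "norm \<beta> = 1" and \<psi>: "0 < \<psi>" "\<psi> < pi"
  shows "cone_transform k g u \<beta> \<psi> = (1 / sin \<psi>)\<^sup>2 *\<^sub>R
    (LINT x|lborel. axis_weight u \<beta> x *\<^sub>R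
      (norm (cone_point u \<beta> (cot \<psi>) x - u) powr (k + 1 - real DIM('a)) *\<^sub>R g (cone_point u \<beta> (cot \<psi>) x)))"
proof -
  let ?C = "circular_cone u \<beta> \<psi>" and ?\<Phi> = "cone_point u \<beta> (cot \<psi>)"
  let ?S = "restrict_space lborel (slab \<beta>)"
  let ?h = "\<lambda>x. indicator ?C x *\<^sub>R (norm (x - u) powr (k - real DIM('a) + 2) *\<^sub>R g x)"
  have s: "sin \<psi> > 0" using \<psi> by (simp add: sin_gt_zero)
  have [measurable]: "?C \<in> sets borel"
    unfolding circular_cone_def by measurable
  have \<Phi>m: "?\<Phi> \<in> ?S \<rightarrow>\<^sub>M borel"
    by (intro measurable_restrict_space1) simp
  have hm: "?h \<in> borel_measurable borel" by measurable
  have "cone_transform k g u \<beta> \<psi> = (LINT x|graph_surface_measure \<beta> (cone_height u \<beta> \<psi>). ?h x)"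
    unfolding cone_transform_def set_lebesgue_integral_def cone_surface_measure_def
    by (rule integral_completion) (simp add: graph_surface_measure_def hm)
  also have "\<dots> = (LINT x|density ?S (\<lambda>_. ennreal (1 / sin \<psi>)). ?h (?\<Phi> x))"
    unfolding graph_surface_measure_cone[OF dim \<beta> \<psi>] using \<Phi>m hm by (intro integral_distr) auto
  also have "\<dots> = (LINT x|?S. (1 / sin \<psi>) *\<^sub>R ?h (?\<Phi> x))"
    using s measurable_compose[OF \<Phi>m hm] by (intro integral_density) auto
  also have "\<dots> = (LINT x|lborel. indicator (slab \<beta>) x *\<^sub>R ((1 / sin \<psi>) *\<^sub>R ?h (?\<Phi> x)))"
    by (rule integral_restrict_space) simp
  also have "\<dots> = (LINT x|lborel. (1 / sin \<psi>)\<^sup>2 *\<^sub>R (axis_weight u \<beta> x *\<^sub>R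
      (norm (?\<Phi> x - u) powr (k + 1 - real DIM('a)) *\<^sub>R g (?\<Phi> x))))"
  proof (rule Bochner_Integration.integral_cong[OF refl])
    fix x
    have "norm (?\<Phi> x - u) powr (k - real DIM('a) + 2) =
        norm (?\<Phi> x - u) powr (k + 1 - real DIM('a)) * (norm (perp \<beta> (x - u)) / sin \<psi>)"
    proof (cases "?\<Phi> x - u = 0")
      case False
      have "norm (?\<Phi> x - u) powr (k - real DIM('a) + 2) =
          norm (?\<Phi> x - u) powr ((k + 1 - real DIM('a)) + 1)"
        by (simp add: algebra_simps)
      also have "\<dots> = norm (?\<Phi> x - u) powr (k + 1 - real DIM('a)) * norm (?\<Phi> x - u)"
        unfolding powr_add using False by simp
      finally show ?thesis unfolding norm_cone_point[OF \<beta> \<psi>, symmetric] .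
    qed simp
    then show "indicator (slab \<beta>) x *\<^sub>R ((1 / sin \<psi>) *\<^sub>R ?h (?\<Phi> x)) = (1 / sin \<psi>)\<^sup>2 *\<^sub>R (axis_weight u \<beta> x *\<^sub>R
      (norm (?\<Phi> x - u) powr (k + 1 - real DIM('a)) *\<^sub>R g (?\<Phi> x)))"
      using cone_point_in_cone[OF \<beta> \<psi>, of u x] by (simp add: axis_weight_def power2_eq_square mult_ac)
  qed
  finally show ?thesis by (simp only: integral_scaleR_right)
qed

text \<open>
  A null set of the space meets almost every cone in a null set of the surface measure. Hence changing
  the representative of \<open>f\<close> affects the transform only for a null set of angles.
\<close>

lemma AE_cone_transform_cong:
  fixes f g :: "'a::euclidean_space \<Rightarrow> complex"
  assumes g[measurable]: "g \<in> borel_measurable borel" and eq: "AE x in lborel. f x = g x"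
    and dim: "DIM('a) \<ge> 2" and \<beta>: "norm \<beta> = 1"
    and \<psi>: "\<And>c. 0 < \<psi> c" "\<And>c. \<psi> c < pi" "\<And>c. cot (\<psi> c) = c"
  shows "AE c in lborel. cone_transform k f u \<beta> (\<psi> c) = cone_transform k g u \<beta> (\<psi> c)"
proof -
  \<comment> \<open>The exceptional set is enclosed in a Borel null set, to which the decomposition into cones applies.\<close>
  obtain N where N: "N \<in> null_sets lborel" and fg: "\<And>x. x \<notin> N \<Longrightarrow> f x = g x"
    using eq by (rule AE_E3) auto
  have [measurable]: "N \<in> sets borel" using N by auto
  have "0 = (\<integral>\<^sup>+x. (\<integral>\<^sup>+c. ennreal (axis_weight u \<beta> x) * indicator N (cone_point u \<beta> c x) \<partial>lborel) \<partial>lborel)"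
    using N by (subst nn_integral_cones[OF _ dim \<beta>]) auto
  also have "\<dots> = (\<integral>\<^sup>+c. (\<integral>\<^sup>+x. ennreal (axis_weight u \<beta> x) * indicator N (cone_point u \<beta> c x) \<partial>lborel) \<partial>lborel)"
    by (rule lborel_pair.Fubini'[symmetric]) measurable
  finally have null: "(\<integral>\<^sup>+c. (\<integral>\<^sup>+x. ennreal (axis_weight u \<beta> x) * indicator N (cone_point u \<beta> c x) \<partial>lborel) \<partial>lborel) = 0"
    by simp
  have "(\<lambda>c. \<integral>\<^sup>+x. ennreal (axis_weight u \<beta> x) * indicator N (cone_point u \<beta> c x) \<partial>lborel) \<in> borel_measurable lborel"
    by measurable
  from nn_integral_0_iff_AE[OF this] null
  have "AE c in lborel. (\<integral>\<^sup>+x. ennreal (axis_weight u \<beta> x) * indicator N (cone_point u \<beta> c x) \<partial>lborel) = 0"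
    by blast
  then show ?thesis
  proof eventually_elim
    case (elim c)
    let ?G = "graph_surface_measure \<beta> (cone_height u \<beta> (\<psi> c))"
    let ?S = "restrict_space lborel (slab \<beta>)"
    have "AE x in lborel. ennreal (axis_weight u \<beta> x) * indicator N (cone_point u \<beta> c x) = 0"
      using elim by (subst (asm) nn_integral_0_iff_AE) auto
    with AE_off_axis[OF dim \<beta>, of u] have "AE x in lborel. x \<in> slab \<beta> \<longrightarrow> cone_point u \<beta> c x \<notin> N"
      by eventually_elim (auto simp: axis_weight_def indicator_def split: if_splits)
    then have "AE x in ?S. cone_point u \<beta> c x \<notin> N"
      by (subst AE_restrict_space_iff) auto
    moreover have m: "cone_point u \<beta> c \<in> ?S \<rightarrow>\<^sub>M borel"
      by (intro measurable_restrict_space1) simp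
    ultimately have "AE x in ?G. x \<notin> N"
      unfolding graph_surface_measure_cone[OF dim \<beta> \<psi>(1,2)] \<psi>(3)
      by (subst AE_distr_iff) (auto simp: AE_density)
    then have G_eq: "AE x in ?G. f x = g x"
      by eventually_elim (rule fg)
    let ?E = "\<lambda>h x. indicator (circular_cone u \<beta> (\<psi> c)) x *\<^sub>R (norm (x - u) powr (k - real DIM('a) + 2) *\<^sub>R h x :: complex)"
    have [measurable]: "circular_cone u \<beta> (\<psi> c) \<in> sets borel"
      unfolding circular_cone_def by measurable
    have gm: "?E g \<in> borel_measurable ?G"
      by (simp add: graph_surface_measure_def)
    have ae: "AE x in completion ?G. ?E f x = ?E g x"
      using AE_completion[OF G_eq] by eventually_elim simp
    show "cone_transform k f u \<beta> (\<psi> c) = cone_transform k g u \<beta> (\<psi> c)"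
      unfolding cone_transform_def set_lebesgue_integral_def cone_surface_measure_def
      by (rule integral_cong_AE[OF borel_measurable_completion_AE_eq[OF gm ae] measurable_completion[OF gm] ae])
  qed
qed

text \<open>
  Integrating the weighted cone transform over all angles gives the Riesz potential at the vertex.
\<close>

lemma riesz_potential_eq_0_if_cone_transform_eq_0:
  fixes f g :: "'a::euclidean_space \<Rightarrow> complex"
  assumes g[measurable]: "g \<in> borel_measurable borel" and eq: "AE x in lborel. f x = g x"
    and dim: "DIM('a) \<ge> 2" and \<beta>: "norm \<beta> = 1"
    and zero: "\<And>\<psi>. 0 < \<psi> \<Longrightarrow> \<psi> < pi \<Longrightarrow> cone_transform k f u \<beta> \<psi> = 0"
    and int: "integrable lborel (\<lambda>x. norm (x - u) powr (k + 1 - real DIM('a)) *\<^sub>R g x)"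
  shows "(LINT x|lborel. norm (x - u) powr (k + 1 - real DIM('a)) *\<^sub>R g x) = 0"
proof -
  let ?h = "\<lambda>x. norm (x - u) powr (k + 1 - real DIM('a)) *\<^sub>R g x"
  let ?M = "density (lborel \<Otimes>\<^sub>M lborel) (\<lambda>(x, c). ennreal (axis_weight u \<beta> x))"
  let ?\<Phi> = "\<lambda>(x, c). cone_point u \<beta> c x"
  \<comment> \<open>The inverse of the cotangent on \<open>(0, \<pi>)\<close>.\<close>
  define \<psi> where "\<psi> c = pi / 2 - arctan c" for c
  have \<psi>: "0 < \<psi> c" "\<psi> c < pi" "cot (\<psi> c) = c" for c
    using arctan_lbound[of c] arctan_ubound[of c] tan_arctan[of c]
    by (auto simp: \<psi>_def cot_def cos_diff sin_diff tan_def)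
  have hm: "?h \<in> borel_measurable borel" by measurable
  have \<Phi>m: "?\<Phi> \<in> ?M \<rightarrow>\<^sub>M borel" by measurable
  have M: "distr ?M borel ?\<Phi> = lborel" by (rule lborel_eq_cones[OF dim \<beta>])
  have "integrable (distr ?M borel ?\<Phi>) ?h" using int unfolding M .
  then have "integrable ?M (\<lambda>z. ?h (?\<Phi> z))"
    using integrable_distr[OF \<Phi>m] by blast
  then have i: "integrable (lborel \<Otimes>\<^sub>M lborel) (\<lambda>(x, c). axis_weight u \<beta> x *\<^sub>R ?h (cone_point u \<beta> c x))"
    by (subst (asm) case_prod_beta', subst (asm) integrable_density)
      (auto simp: case_prod_beta' axis_weight_nonneg)
  have "(LINT x|lborel. ?h x) = (LINT x|distr ?M borel ?\<Phi>. ?h x)"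
    unfolding M ..
  also have "\<dots> = (LINT z|?M. ?h (?\<Phi> z))"
    by (rule integral_distr[OF \<Phi>m hm])
  also have "\<dots> = (LINT z|(lborel \<Otimes>\<^sub>M lborel). (case z of (x, c) \<Rightarrow> axis_weight u \<beta> x *\<^sub>R ?h (cone_point u \<beta> c x)))"
    by (subst case_prod_beta', subst integral_density)
      (auto simp: case_prod_beta' axis_weight_nonneg)
  also have "\<dots> = (LINT c|lborel. (LINT x|lborel. axis_weight u \<beta> x *\<^sub>R ?h (cone_point u \<beta> c x)))"
    by (rule lborel_pair.integral_snd[OF i, symmetric])
  also have "\<dots> = 0"
  proof (rule integral_eq_zero_AE)
    show "AE c in lborel. (LINT x|lborel. axis_weight u \<beta> x *\<^sub>R ?h (cone_point u \<beta> c x)) = 0"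
      using AE_cone_transform_cong[OF g eq dim \<beta> \<psi>, where k=k and u=u]
    proof eventually_elim
      case (elim c)
      have "sin (\<psi> c) \<noteq> 0" using sin_gt_zero[OF \<psi>(1,2)[of c]] by simp
      then show ?case
        using elim zero[OF \<psi>(1,2)[of c]] cone_transform_borel[OF g dim \<beta> \<psi>(1,2)[of c], of k u]
        by (simp add: \<psi>(3))
    qed
  qed
  finally show ?thesis .
qed

section \<open>Powers of the norm off a ball\<close>

text \<open>
  The space outside the ball is covered by the shells on which \<open>norm z\<close> is between \<open>2 ^ k * \<rho>\<close> and \<open>2 ^ (k + 1) * \<rho>\<close>. A
  shell has volume of order \<open>(2 ^ k) ^ n\<close>, so the integrals over the shells are dominated by a geometric series.
\<close>

lemma integrable_powr_outside_ball:
  fixes q \<rho> :: real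
  assumes q: "q > real DIM('a::euclidean_space)" and \<rho>: "\<rho> > 0"
  shows "integrable lborel (\<lambda>z::'a. indicator {z. \<rho> \<le> norm z} z * norm z powr (- q))"
proof (rule integrableI_bounded)
  let ?n = "DIM('a)"
  define c where "c k = (2 ^ k * \<rho>) powr (- q)" for k :: nat
  define A where "A = \<rho> powr (- q) * (unit_ball_vol (real ?n) * (2 * \<rho>) ^ ?n)"
  define x where "x = 2 powr (real ?n - q)"
  have x: "0 < x" "x < 1"
    using q by (auto simp: x_def powr_less_one)
  have A: "A \<ge> 0" using \<rho> by (simp add: A_def)
  have shell: "ennreal (norm (indicator {z. \<rho> \<le> norm z} z * norm z powr (- q)))
      \<le> (\<Sum>k. ennreal (c k) * indicator (ball 0 (2 ^ Suc k * \<rho>)) z)" for z :: 'a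
  proof (cases "\<rho> \<le> norm z")
    case True
    define k where "k = (LEAST k. norm z < 2 ^ Suc k * \<rho>)"
    obtain m :: nat where "norm z / \<rho> < 2 ^ m"
      using real_arch_pow[of 2 "norm z / \<rho>"] by auto
    then have "norm z < 2 ^ m * \<rho>" using \<rho> by (simp add: field_simps)
    also have "\<dots> \<le> 2 ^ Suc m * \<rho>" using \<rho> by simp
    finally have k: "norm z < 2 ^ Suc k * \<rho>"
      unfolding k_def by (rule LeastI)
    have "2 ^ k * \<rho> \<le> norm z"
    proof (cases k)
      case 0
      then show ?thesis using True by simp
    next
      case (Suc j)
      then have "\<not> norm z < 2 ^ Suc j * \<rho>"
        using not_less_Least[of j "\<lambda>k. norm z < 2 ^ Suc k * \<rho>"] by (simp add: k_def)
      then show ?thesis using Suc by simp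
    qed
    then have "norm z powr (- q) \<le> c k"
      unfolding c_def using q \<rho> by (intro powr_mono2') auto
    have summand: "F k \<le> (\<Sum>k. F k)" for F :: "nat \<Rightarrow> ennreal"
      using sum_le_suminf[of F "{k}"] by simp
    from \<open>norm z powr (- q) \<le> c k\<close> have "ennreal (norm (indicator {z. \<rho> \<le> norm z} z * norm z powr (- q)))
        \<le> ennreal (c k) * indicator (ball 0 (2 ^ Suc k * \<rho>)) z"
      using True k by (simp add: ennreal_leI)
    also have "\<dots> \<le> (\<Sum>k. ennreal (c k) * indicator (ball 0 (2 ^ Suc k * \<rho>)) z)"
      by (rule summand)
    finally show ?thesis .
  qed simp
  have shell_integral: "ennreal (c k) * emeasure lborel (ball (0::'a) (2 ^ Suc k * \<rho>)) = ennreal (A * x ^ k)" for k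
  proof -
    have scaling: "c k * (2 ^ Suc k * \<rho>) ^ ?n = \<rho> powr (- q) * (2 * \<rho>) ^ ?n * x ^ k"
    proof -
      have "c k = (2 ^ k) powr (- q) * \<rho> powr (- q)"
        unfolding c_def using \<rho> by (intro powr_mult)
      moreover have "(2 ^ Suc k * \<rho>) ^ ?n = (2 ^ k) ^ ?n * (2 * \<rho>) ^ ?n"
        by (simp add: power_mult_distrib mult_ac)
      moreover have "(2 ^ k) powr (- q) * (2 ^ k) ^ ?n = x ^ k"
      proof -
        have "(2 ^ k) powr (- q) * (2 ^ k) ^ ?n = (2 ^ k) powr (- q) * (2 ^ k) powr real ?n"
          by (subst powr_realpow) auto
        also have "\<dots> = (2 ^ k) powr (real ?n - q)"
          by (simp flip: powr_add)
        also have "\<dots> = (2 powr real k) powr (real ?n - q)"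
          by (simp add: powr_realpow)
        also have "\<dots> = (2 powr (real ?n - q)) powr real k"
          by (simp add: powr_powr mult.commute)
        also have "\<dots> = x ^ k"
          using x by (simp add: x_def powr_realpow)
        finally show ?thesis .
      qed
      ultimately show ?thesis by (simp add: mult_ac)
    qed
    have "ennreal (c k) * emeasure lborel (ball (0::'a) (2 ^ Suc k * \<rho>)) =
        ennreal (c k * (unit_ball_vol (real ?n) * (2 ^ Suc k * \<rho>) ^ ?n))"
      using \<rho> by (subst emeasure_ball) (auto simp: c_def simp flip: ennreal_mult')
    also have "\<dots> = ennreal (unit_ball_vol (real ?n) * (c k * (2 ^ Suc k * \<rho>) ^ ?n))"
      by (simp only: mult.left_commute)
    also have "\<dots> = ennreal (A * x ^ k)"
      unfolding scaling by (simp add: A_def mult_ac)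
    finally show ?thesis .
  qed
  have [measurable]: "ball (0::'a) R \<in> sets borel" for R
    by simp
  have cmult: "(\<integral>\<^sup>+ z. c * indicator (ball y R) z \<partial>lborel) = c * emeasure lborel (ball y R)" for c R and y :: 'a
    by (rule nn_integral_cmult_indicator) simp
  have "(\<integral>\<^sup>+ (z::'a). ennreal (norm (indicator {z. \<rho> \<le> norm z} z * norm z powr (- q))) \<partial>lborel)
      \<le> (\<integral>\<^sup>+ (z::'a). (\<Sum>k. ennreal (c k) * indicator (ball 0 (2 ^ Suc k * \<rho>)) z) \<partial>lborel)"
    by (rule nn_integral_mono) (rule shell)
  also have "\<dots> = (\<Sum>k. ennreal (c k) * emeasure lborel (ball (0::'a) (2 ^ Suc k * \<rho>)))"
    by (subst nn_integral_suminf) (simp_all only: cmult, measurable)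
  also have "\<dots> = ennreal (\<Sum>k. A * x ^ k)"
    unfolding shell_integral using A x by (intro suminf_ennreal2 summable_mult summable_geometric) auto
  also have "\<dots> < \<infinity>" by simp
  finally show "(\<integral>\<^sup>+ (z::'a). ennreal (norm (indicator {z. \<rho> \<le> norm z} z * norm z powr (- q))) \<partial>lborel) < \<infinity>" .
qed measurable

text \<open>
  Hoelder's inequality in the guise of Young's: the condition on the exponents says that \<open>norm z powr a\<close> is in the
  dual Lebesgue space outside the ball.
\<close>

lemma integrable_powr_mult_outside_ball:
  fixes g :: "'a::euclidean_space \<Rightarrow> complex" and a p \<rho> :: real
  assumes [measurable]: "g \<in> borel_measurable borel"
    and Lp: "integrable lborel (\<lambda>x. norm (g x) powr p)"
    and p: "p \<ge> 1" and a: "a < 0" and exponents: "real DIM('a) * (p - 1) < - a * p"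
    and \<rho>: "\<rho> > 0" and zero: "\<And>z. norm z < \<rho> \<Longrightarrow> g z = 0"
  shows "integrable lborel (\<lambda>z. norm z powr a *\<^sub>R g z)"
proof (cases "p = 1")
  case True
  show ?thesis
  proof (rule Bochner_Integration.integrable_bound)
    show "integrable lborel (\<lambda>z. \<rho> powr a * norm (g z) powr p)"
      using Lp by (rule integrable_mult_right)
    show "AE z in lborel. norm (norm z powr a *\<^sub>R g z) \<le> norm (\<rho> powr a * norm (g z) powr p)"
    proof (rule AE_I2)
      fix z
      show "norm (norm z powr a *\<^sub>R g z) \<le> norm (\<rho> powr a * norm (g z) powr p)"
      proof (cases "norm z < \<rho>")
        case False
        then have "norm z powr a \<le> \<rho> powr a"
          using a \<rho> by (intro powr_mono2') auto
        then show ?thesis using True by (simp add: abs_mult mult_right_mono)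
      qed (simp add: zero)
    qed
  qed measurable
next
  case False
  with p have p1: "p > 1" by simp
  define q where "q = p / (p - 1)"
  have q1: "q > 1" and pq: "1 / p + 1 / q = 1"
    using p1 by (auto simp: q_def field_simps)
  have aq: "- a * q > real DIM('a)"
    using exponents p1 by (simp add: q_def field_simps)
  show ?thesis
  proof (rule Bochner_Integration.integrable_bound)
    show "integrable lborel (\<lambda>z. norm (g z) powr p +
        indicator {z. \<rho> \<le> norm z} z * norm z powr (- (- a * q)))"
      by (intro Bochner_Integration.integrable_add Lp integrable_powr_outside_ball aq \<rho>)
    show "AE z in lborel. norm (norm z powr a *\<^sub>R g z) \<le> norm (norm (g z) powr p +
        indicator {z. \<rho> \<le> norm z} z * norm z powr (- (- a * q)))"
    proof (rule AE_I2)
      fix z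
      show "norm (norm z powr a *\<^sub>R g z) \<le> norm (norm (g z) powr p +
        indicator {z. \<rho> \<le> norm z} z * norm z powr (- (- a * q)))"
      proof (cases "norm z < \<rho>")
        case False
        have "norm (norm z powr a *\<^sub>R g z) = norm (g z) * norm z powr a"
          by simp
        also have "\<dots> \<le> norm (g z) powr p / p + (norm z powr a) powr q / q"
          using p1 q1 pq by (intro Youngs_inequality) auto
        also have "\<dots> \<le> norm (g z) powr p + (norm z powr a) powr q"
          using p1 q1 by (intro add_mono) (simp_all add: divide_le_eq mult_left_mono_neg mult_le_cancel_left1)
        finally show ?thesis
          using False by (simp add: powr_powr)
      qed (simp add: zero)
    qed
  qed measurable
qed

section \<open>Measures with vanishing moments\<close>

text \<open>
  Linear combinations of exponentials of linear forms. Unlike the powers of linear forms, the exponentials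
  are closed under multiplication, so that their combinations form an algebra to which the theorem of
  Stone and Weierstrass applies.
\<close>

inductive_set exp_span :: "('b::euclidean_space \<Rightarrow> real) set" where
  exp: "(\<lambda>y. c * exp (y \<bullet> w)) \<in> exp_span"
| add: "p \<in> exp_span \<Longrightarrow> q \<in> exp_span \<Longrightarrow> (\<lambda>y. p y + q y) \<in> exp_span"

lemma exp_span_mult:
  assumes p: "p \<in> exp_span" and q: "q \<in> exp_span"
  shows "(\<lambda>y. p y * q y) \<in> exp_span"
  using p
proof induction
  case (exp c v)
  from q show ?case
  proof induction
    case (exp d w)
    have "(\<lambda>y. (c * d) * exp (y \<bullet> (v + w))) \<in> exp_span"
      by (rule exp_span.exp)
    then show ?case
      by (simp add: inner_add_right exp_add mult_ac)
  next
    case (add p q)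
    from exp_span.add[OF add.IH] show ?case
      by (simp add: ring_distribs)
  qed
next
  case (add p1 p2)
  from exp_span.add[OF add.IH] show ?case
    by (simp add: ring_distribs)
qed

lemma continuous_on_exp_span: "p \<in> exp_span \<Longrightarrow> continuous_on S p"
  by (induction rule: exp_span.induct) (auto intro!: continuous_intros)

lemma function_ring_on_exp_span:
  fixes S :: "'b::euclidean_space set"
  assumes "compact S"
  shows "function_ring_on exp_span S"
proof
  show "(\<lambda>_. c) \<in> exp_span" for c
    using exp_span.exp[of c 0] by simp
  show "\<exists>f\<in>exp_span. f x \<noteq> f y" if "x \<noteq> y" for x y :: 'b
  proof
    \<comment> \<open>The exponential in direction \<open>x - y\<close> separates the two points.\<close>
    have "x \<bullet> (x - y) \<noteq> y \<bullet> (x - y)"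
      using that by (metis inner_diff_left inner_eq_zero_iff right_minus_eq)
    then show "(\<lambda>z. 1 * exp (z \<bullet> (x - y))) x \<noteq> (\<lambda>z. 1 * exp (z \<bullet> (x - y))) y"
      by simp
  qed (rule exp_span.exp)
qed (auto intro: assms exp_span.add exp_span_mult continuous_on_exp_span)

text \<open>
  A complex measure with density \<open>g\<close> whose push-forward under \<open>Y\<close> has compact support and annihilates all powers of
  linear forms.
\<close>

locale vanishing_moments =
  fixes M :: "'a measure" and g :: "'a \<Rightarrow> complex"
    and Y :: "'a \<Rightarrow> 'b::euclidean_space" and R :: real
  assumes g[intro]: "integrable M g"
    and Y[measurable]: "Y \<in> borel_measurable M"
    and bound: "\<And>z. g z \<noteq> 0 \<Longrightarrow> norm (Y z) \<le> R"
    and moments: "\<And>w N. (LINT z|M. (Y z \<bullet> w) ^ N *\<^sub>R g z) = 0"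
begin

lemma g_measurable[measurable]: "g \<in> borel_measurable M"
  using g by (rule borel_measurable_integrable)

lemma integrable_bounded:
  assumes F[measurable]: "F \<in> borel_measurable borel"
    and c: "\<And>y. norm y \<le> R \<Longrightarrow> \<bar>F y\<bar> \<le> c"
  shows "integrable M (\<lambda>z. F (Y z) *\<^sub>R g z)"
proof (rule Bochner_Integration.integrable_bound)
  show "integrable M (\<lambda>z. c * norm (g z))" using g by simp
  show "AE z in M. norm (F (Y z) *\<^sub>R g z) \<le> norm (c * norm (g z))"
  proof (rule AE_I2)
    fix z
    show "norm (F (Y z) *\<^sub>R g z) \<le> norm (c * norm (g z))"
    proof (cases "g z = 0")
      case False
      from c[OF bound[OF False]] have "\<bar>F (Y z)\<bar> \<le> \<bar>c\<bar>" by simp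
      then show ?thesis by (simp add: abs_mult mult_right_mono)
    qed simp
  qed
qed measurable

lemma power_integrable: "integrable M (\<lambda>z. (Y z \<bullet> w) ^ N *\<^sub>R g z)"
proof (rule integrable_bounded[of "\<lambda>y. (y \<bullet> w) ^ N"])
  fix y :: 'b assume "norm y \<le> R"
  then have "\<bar>y \<bullet> w\<bar> \<le> R * norm w"
    using Cauchy_Schwarz_ineq2[of y w] by (meson mult_right_mono norm_ge_zero order_trans)
  then show "\<bar>(y \<bullet> w) ^ N\<bar> \<le> (R * norm w) ^ N"
    by (simp add: power_abs power_mono)
qed measurable

text \<open>
  The exponential series converges boundedly on the support of the push-forward.
\<close>

lemma exp_moment: "(LINT z|M. exp (Y z \<bullet> w) *\<^sub>R g z) = 0"
proof -
  define S where "S n z = (\<Sum>k<n. inverse (fact k) *\<^sub>R (Y z \<bullet> w) ^ k *\<^sub>R g z)" for n z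
  have S0: "(LINT z|M. S n z) = 0" for n
    unfolding S_def
    by (subst Bochner_Integration.integral_sum)
      (simp_all add: power_integrable moments del: scaleR_scaleR)
  have S_eq: "S n z = (\<Sum>k<n. (Y z \<bullet> w) ^ k /\<^sub>R fact k) *\<^sub>R g z" for n z
    by (simp add: S_def scaleR_sum_left)
  have "(\<lambda>n. LINT z|M. S n z) \<longlonglongrightarrow> (LINT z|M. exp (Y z \<bullet> w) *\<^sub>R g z)"
  proof (rule integral_dominated_convergence)
    show "integrable M (\<lambda>z. exp (R * norm w) * norm (g z))" using g by simp
    show "AE z in M. (\<lambda>n. S n z) \<longlonglongrightarrow> exp (Y z \<bullet> w) *\<^sub>R g z"
      unfolding S_eq using exp_converges[of "Y _ \<bullet> w"]
      by (intro AE_I2 tendsto_scaleR tendsto_const) (simp add: sums_def)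
    show "AE z in M. norm (S n z) \<le> exp (R * norm w) * norm (g z)" for n
    proof (rule AE_I2)
      fix z
      show "norm (S n z) \<le> exp (R * norm w) * norm (g z)"
      proof (cases "g z = 0")
        case False
        let ?x = "Y z \<bullet> w"
        have "norm (\<Sum>k<n. ?x ^ k /\<^sub>R fact k) \<le> (\<Sum>k<n. \<bar>?x\<bar> ^ k /\<^sub>R fact k)"
          by (rule order_trans[OF norm_sum]) (simp add: power_abs abs_mult)
        also have "\<dots> \<le> exp \<bar>?x\<bar>"
          unfolding exp_def
          by (rule sum_le_suminf) (auto intro: summable_exp)
        also have "\<dots> \<le> exp (R * norm w)"
          using Cauchy_Schwarz_ineq2[of "Y z" w] bound[OF False]
          by (simp, meson mult_right_mono norm_ge_zero order_trans)
        finally show ?thesis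
          unfolding S_eq by (simp add: mult_right_mono)
      qed (simp add: S_eq)
    qed
  qed (unfold S_def, measurable)
  then show ?thesis
    unfolding S0 by (simp add: LIMSEQ_const_iff)
qed

lemma exp_span_bounded:
  assumes "p \<in> exp_span"
  obtains c where "\<And>y. norm y \<le> R \<Longrightarrow> \<bar>p y\<bar> \<le> c"
proof -
  have "bounded (p ` cball 0 R)"
    using assms continuous_on_exp_span
    by (intro compact_imp_bounded compact_continuous_image) auto
  then show thesis
    using that by (force simp: bounded_iff)
qed

lemma exp_span_measurable: "p \<in> exp_span \<Longrightarrow> p \<in> borel_measurable borel"
  using continuous_on_exp_span[of p UNIV] borel_measurable_continuous_onI by blast

lemma exp_span_integrable:
  "p \<in> exp_span \<Longrightarrow> integrable M (\<lambda>z. p (Y z) *\<^sub>R g z)"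
  by (metis exp_span_bounded exp_span_measurable integrable_bounded)

lemma exp_span_moment:
  "p \<in> exp_span \<Longrightarrow> (LINT z|M. p (Y z) *\<^sub>R g z) = 0"
proof (induction rule: exp_span.induct)
  case (exp c w)
  then show ?case
    using exp_moment[of w] by (simp flip: scaleR_scaleR)
next
  case (add p q)
  then show ?case
    using exp_span_integrable by (simp add: scaleR_add_left)
qed

lemma continuous_moment:
  assumes F: "continuous_on UNIV F"
  shows "(LINT z|M. F (Y z) *\<^sub>R g z) = 0"
proof -
  have Fm[measurable]: "F \<in> borel_measurable borel"
    using F by (rule borel_measurable_continuous_onI)
  interpret function_ring_on exp_span "cball 0 R :: 'b set"
    by (rule function_ring_on_exp_span) simp
  have "norm (LINT z|M. F (Y z) *\<^sub>R g z) \<le> e * (LINT z|M. norm (g z))" if e: "e > 0" for e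
  proof -
    obtain p where p: "p \<in> exp_span" and close: "\<And>y. y \<in> cball 0 R \<Longrightarrow> \<bar>F y - p y\<bar> < e"
      using Stone_Weierstrass_basic[OF continuous_on_subset[OF F subset_UNIV] e] by (metis that)
    have [measurable]: "p \<in> borel_measurable borel" using p by (rule exp_span_measurable)
    have i1: "integrable M (\<lambda>z. (F (Y z) - p (Y z)) *\<^sub>R g z)"
      by (rule integrable_bounded[of "\<lambda>y. F y - p y" e]) (use close in \<open>auto simp: less_imp_le\<close>)
    have "F (Y z) *\<^sub>R g z = (F (Y z) - p (Y z)) *\<^sub>R g z + p (Y z) *\<^sub>R g z" for z
      by (simp add: scaleR_diff_left)
    then have "(LINT z|M. F (Y z) *\<^sub>R g z) = (LINT z|M. (F (Y z) - p (Y z)) *\<^sub>R g z)"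
      using i1 exp_span_integrable[OF p] exp_span_moment[OF p] by simp
    also have "norm \<dots> \<le> (LINT z|M. norm ((F (Y z) - p (Y z)) *\<^sub>R g z))"
      by (rule integral_norm_bound)
    also have "\<dots> \<le> (LINT z|M. e * norm (g z))"
    proof (rule integral_mono[OF integrable_norm[OF i1]])
      fix z
      show "norm ((F (Y z) - p (Y z)) *\<^sub>R g z) \<le> e * norm (g z)"
        using close[of "Y z"] bound[of z] by (cases "g z = 0") (auto intro!: mult_right_mono)
    qed (use g in simp)
    finally show ?thesis by simp
  qed
  then have "norm (LINT z|M. F (Y z) *\<^sub>R g z) \<le> 0 * (LINT z|M. norm (g z))"
    by (intro tendsto_le[OF _ tendsto_mult_right[of "\<lambda>e. e" 0 "at_right 0"] tendsto_const])
      (auto simp: eventually_at_right_less intro: eventually_mono[OF eventually_at_right_less])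
  then show ?thesis by simp
qed

text \<open>
  The indicator function of a closed set is the limit of a decreasing sequence of continuous functions.
\<close>

lemma closed_moment:
  assumes A: "closed A"
  shows "(LINT z|M. indicator A (Y z) *\<^sub>R g z) = 0"
proof (cases "A = {}")
  case False
  define F where "F n y = max 0 (1 - real n * infdist y A)" for n :: nat and y
  have cF: "continuous_on UNIV (F n)" for n
    unfolding F_def by (intro continuous_intros)
  have [measurable]: "F n \<in> borel_measurable borel" for n
    using cF by (rule borel_measurable_continuous_onI)
  have [measurable]: "A \<in> sets borel" using A by simp
  have "(\<lambda>n. LINT z|M. F n (Y z) *\<^sub>R g z) \<longlonglongrightarrow> (LINT z|M. indicator A (Y z) *\<^sub>R g z)"
  proof (rule integral_dominated_convergence)
    show "integrable M (\<lambda>z. norm (g z))" using g by simp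
    show "AE z in M. norm (F n (Y z) *\<^sub>R g z) \<le> norm (g z)" for n
      by (rule AE_I2) (auto simp: F_def infdist_nonneg intro!: mult_left_le_one_le)
    have "(\<lambda>n. F n y) \<longlonglongrightarrow> indicator A y" for y
    proof (cases "y \<in> A")
      case True
      then show ?thesis by (simp add: F_def)
    next
      case y: False
      have d: "infdist y A > 0"
        using infdist_pos_not_in_closed[OF A False y] .
      then obtain m :: nat where m: "1 / infdist y A < real m"
        using reals_Archimedean2 by blast
      have "F n y = 0" if "n \<ge> m" for n
      proof -
        have "1 < real m * infdist y A" using m d by (simp add: field_simps)
        also have "\<dots> \<le> real n * infdist y A" using that d by simp
        finally show ?thesis by (simp add: F_def)
      qed
      then have "eventually (\<lambda>n. F n y = 0) sequentially"
        by (auto simp: eventually_sequentially)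
      then show ?thesis using y by (simp add: tendsto_eventually)
    qed
    then show "AE z in M. (\<lambda>n. F n (Y z) *\<^sub>R g z) \<longlonglongrightarrow> indicator A (Y z) *\<^sub>R g z"
      by (intro AE_I2 tendsto_scaleR tendsto_const)
  qed measurable
  then show ?thesis
    unfolding continuous_moment[OF cF] by (simp add: LIMSEQ_const_iff)
qed simp

text \<open>
  The closed sets are stable under intersection and generate the Borel sets.
\<close>

lemma borel_moment:
  assumes "A \<in> sets borel"
  shows "(LINT z|M. indicator A (Y z) *\<^sub>R g z) = 0"
proof -
  have "A \<in> sigma_sets UNIV (Collect closed)"
    using assms by (simp add: borel_eq_closed)
  have "Int_stable (Collect closed :: 'b set set)" and "Collect closed \<subseteq> Pow (UNIV :: 'b set)"
    by (auto simp: Int_stable_def)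
  from this \<open>A \<in> sigma_sets UNIV (Collect closed)\<close> show ?thesis
  proof (induction rule: sigma_sets_induct_disjoint)
    case (compl A)
    then have [measurable]: "A \<in> sets borel"
      by (simp add: borel_eq_closed)
    have "indicator (UNIV - A) (Y z) *\<^sub>R g z = g z - indicator A (Y z) *\<^sub>R g z" for z
      by (simp add: indicator_def)
    moreover have "integrable M (\<lambda>z. indicator A (Y z) *\<^sub>R g z)"
      by (rule integrable_bounded[of "indicator A" 1]) auto
    moreover have "(LINT z|M. g z) = 0"
      using continuous_moment[of "\<lambda>_. 1"] by simp
    ultimately show ?case using compl g by simp
  next
    case (union B)
    have [measurable]: "B i \<in> sets borel" for i
      using union.hyps(2) by (auto simp: borel_eq_closed)
    have B: "Y -` B i \<inter> space M \<in> sets M" for i by measurable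
    have "(LINT z:(\<Union>i. Y -` B i \<inter> space M)|M. g z) =
        (\<Sum>i. LINT z:(Y -` B i \<inter> space M)|M. g z)"
    proof (rule lebesgue_integral_countable_add)
      show "set_integrable M (\<Union>i. Y -` B i \<inter> space M) g"
        unfolding set_integrable_def using B
        by (intro integrable_mult_indicator g) auto
      show "(Y -` B i \<inter> space M) \<inter> (Y -` B j \<inter> space M) = {}" if "i \<noteq> j" for i j
        using union.hyps(1) that unfolding disjoint_family_on_def by blast
    qed (rule B)
    moreover have "(LINT z:(Y -` B i \<inter> space M)|M. g z) = (LINT z|M. indicator (B i) (Y z) *\<^sub>R g z)" for i
      unfolding set_lebesgue_integral_def
      by (rule Bochner_Integration.integral_cong) (auto simp: indicator_def)
    moreover have "(LINT z:(\<Union>i. Y -` B i \<inter> space M)|M. g z) = (LINT z|M. indicator (\<Union>i. B i) (Y z) *\<^sub>R g z)"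
      unfolding set_lebesgue_integral_def
      by (rule Bochner_Integration.integral_cong) (auto simp: indicator_def)
    ultimately show ?case using union.IH by simp
  qed (auto simp: closed_moment)
qed

text \<open>
  If \<open>Y\<close> has a measurable left inverse, every measurable set is the preimage under \<open>Y\<close> of a Borel set, so that the integral
  of \<open>g\<close> over every measurable set vanishes.
\<close>

theorem AE_zero_if_left_inverse:
  assumes "sigma_finite_measure M"
    and Z: "Z \<in> borel \<rightarrow>\<^sub>M M" and ZY: "\<And>z. z \<in> space M \<Longrightarrow> Z (Y z) = z"
  shows "AE z in M. g z = 0"
proof (rule sigma_finite_measure.density_zero[OF assms(1) g])
  fix A assume A: "A \<in> sets M"
  have "Z -` A \<in> sets borel"
    using measurable_sets[OF Z A] by simp
  from borel_moment[OF this] show "(LINT z:A|M. g z) = 0"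
    unfolding set_lebesgue_integral_def
    by (subst (asm) Bochner_Integration.integral_cong[OF refl, where g="\<lambda>z. indicator A z *\<^sub>R g z"])
      (auto simp: indicator_def ZY)
qed

end

section \<open>Unique continuation for Riesz potentials\<close>

text \<open>
  The reflection in the unit sphere, with the origin as an additional fixed point.
\<close>

definition inversion :: "'a::real_inner \<Rightarrow> 'a" where
  "inversion z = z /\<^sub>R (norm z)\<^sup>2"

lemma norm_inversion: "norm (inversion z) = 1 / norm z"
  by (cases "z = 0") (simp_all add: inversion_def divide_inverse power2_eq_square)

lemma inversion_inversion: "inversion (inversion z) = z"
proof (cases "z = 0")
  case False
  have "inversion (inversion z) = inversion z /\<^sub>R (1 / norm z)\<^sup>2"
    by (subst inversion_def) (simp add: norm_inversion)
  also have "\<dots> = z"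
    using False by (simp add: inversion_def power_divide)
  finally show ?thesis .
qed (simp add: inversion_def)

lemma inversion_measurable[measurable]:
  "(inversion :: 'a::euclidean_space \<Rightarrow> 'a) \<in> borel_measurable borel"
  unfolding inversion_def by measurable

text \<open>
  A family of kernels that contains the powers of the norm and in which the derivative of every member,
  in the direction of its own linear form, is a combination of two members.
\<close>

definition riesz_kernel :: "nat \<Rightarrow> 'a::real_inner \<Rightarrow> real \<Rightarrow> 'a \<Rightarrow> real" where
  "riesz_kernel N w b z = (z \<bullet> w) ^ N * norm z powr b"

lemma riesz_kernel_measurable[measurable]:
  "riesz_kernel N (w::'a::euclidean_space) b \<in> borel_measurable borel"
  unfolding riesz_kernel_def by measurable

lemma riesz_kernel_0: "riesz_kernel 0 w b z = norm z powr b"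
  by (simp add: riesz_kernel_def)

lemma DERIV_riesz_kernel:
  assumes z: "z \<noteq> 0"
  shows "((\<lambda>t. riesz_kernel N w b (z + t *\<^sub>R w)) has_real_derivative
    (real N * (w \<bullet> w) * riesz_kernel (N - 1) w b z + b * riesz_kernel (Suc N) w (b - 2) z)) (at 0)"
proof -
  \<comment> \<open>The norm is written as a power of a quadratic form, to avoid the derivative of the square root.\<close>
  have sq: "norm x powr b = (x \<bullet> x) powr (b / 2)" for x :: 'a
    by (simp add: norm_eq_sqrt_inner powr_half_sqrt[symmetric] powr_powr)
  have zz: "(z \<bullet> z) powr (b / 2 - 1) = norm z powr (b - 2)"
  proof -
    have "norm z powr (b - 2) = (z \<bullet> z) powr ((b - 2) / 2)"
      by (simp add: norm_eq_sqrt_inner powr_half_sqrt[symmetric] powr_powr)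
    then show ?thesis by (simp add: diff_divide_distrib)
  qed
  have d1: "((\<lambda>t. (z + t *\<^sub>R w) \<bullet> w) has_real_derivative w \<bullet> w) (at 0)"
    unfolding inner_add_left inner_scaleR_left by (auto intro!: derivative_eq_intros)
  have "((\<lambda>t. z \<bullet> z + 2 * t * (z \<bullet> w) + t\<^sup>2 * (w \<bullet> w)) has_real_derivative 2 * (z \<bullet> w)) (at 0)"
    by (auto intro!: derivative_eq_intros)
  moreover have "(z + t *\<^sub>R w) \<bullet> (z + t *\<^sub>R w) = z \<bullet> z + 2 * t * (z \<bullet> w) + t\<^sup>2 * (w \<bullet> w)" for t
    by (simp add: inner_add_left inner_add_right inner_commute[of w z] power2_eq_square distrib_left)
  ultimately have d2: "((\<lambda>t. (z + t *\<^sub>R w) \<bullet> (z + t *\<^sub>R w)) has_real_derivative 2 * (z \<bullet> w)) (at 0)"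
    by simp
  have d3: "((\<lambda>t. ((z + t *\<^sub>R w) \<bullet> (z + t *\<^sub>R w)) powr (b / 2)) has_real_derivative
      b / 2 * (z \<bullet> z) powr (b / 2 - 1) * (2 * (z \<bullet> w))) (at 0)"
    using DERIV_fun_powr[OF d2, of "b / 2"] z by simp
  have "((\<lambda>t. ((z + t *\<^sub>R w) \<bullet> w) ^ N * ((z + t *\<^sub>R w) \<bullet> (z + t *\<^sub>R w)) powr (b / 2)) has_real_derivative
      (real N * (z \<bullet> w) ^ (N - 1) * (w \<bullet> w)) * (z \<bullet> z) powr (b / 2) +
      (b / 2 * (z \<bullet> z) powr (b / 2 - 1) * (2 * (z \<bullet> w))) * (z \<bullet> w) ^ N) (at 0)"
    using DERIV_mult[OF DERIV_power[OF d1, of N] d3] by (simp add: mult_ac)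
  then show ?thesis
    unfolding riesz_kernel_def sq[symmetric] zz by (simp add: mult_ac)
qed

text \<open>
  The function \<open>g\<close> vanishes on a ball of radius \<open>2 r\<close>, and the vertices \<open>u\<close> range over the ball of radius \<open>r\<close>, so that \<open>z - u\<close> stays
  comparable to \<open>z\<close> on the support of \<open>g\<close> and the kernels are never evaluated near their singularity.
\<close>

locale supported_off_ball =
  fixes g :: "'a::euclidean_space \<Rightarrow> complex" and r a :: real
  assumes g_measurable[measurable]: "g \<in> borel_measurable borel"
    and r: "r > 0" and a: "a < 0"
    and g_zero: "\<And>z. norm z < 2 * r \<Longrightarrow> g z = 0"
    and g_integrable: "integrable lborel (\<lambda>z. norm z powr a *\<^sub>R g z)"
begin

text \<open>
  The bound by the kernel of the potential makes \<open>k (z - u) *\<^sub>R g z\<close> integrable for all vertices \<open>u\<close> near the origin.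
\<close>

definition admissible :: "('a \<Rightarrow> real) \<Rightarrow> bool" where
  "admissible k \<longleftrightarrow> k \<in> borel_measurable borel \<and>
     (\<exists>C. \<forall>z. r \<le> norm z \<longrightarrow> \<bar>k z\<bar> \<le> C * norm z powr a)"

text \<open>
  The convolution of \<open>g\<close> with the reflected kernel vanishes near the origin.
\<close>

definition annihilates :: "('a \<Rightarrow> real) \<Rightarrow> bool" where
  "annihilates k \<longleftrightarrow> (\<forall>u. norm u < r \<longrightarrow> (LINT z|lborel. k (z - u) *\<^sub>R g z) = 0)"

lemma admissible_measurable: "admissible k \<Longrightarrow> k \<in> borel_measurable borel"
  by (simp add: admissible_def)

lemma admissible_shift_bound:
  assumes "admissible k"
  obtains C where "\<And>z u. norm u < r \<Longrightarrow> 2 * r \<le> norm z \<Longrightarrow> \<bar>k (z - u)\<bar> \<le> C * norm z powr a"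
proof -
  obtain C where C: "\<And>z. r \<le> norm z \<Longrightarrow> \<bar>k z\<bar> \<le> C * norm z powr a"
    using assms unfolding admissible_def by blast
  have "\<bar>k (z - u)\<bar> \<le> (\<bar>C\<bar> * (1/2) powr a) * norm z powr a"
    if u: "norm u < r" and z: "2 * r \<le> norm z" for z u
  proof -
    have h: "norm z / 2 \<le> norm (z - u)"
      using norm_triangle_ineq2[of z u] u z by linarith
    have "\<bar>k (z - u)\<bar> \<le> C * norm (z - u) powr a"
      using h z by (intro C) linarith
    also have "\<dots> \<le> \<bar>C\<bar> * norm (z - u) powr a"
      by (intro mult_right_mono) auto
    also have "\<dots> \<le> \<bar>C\<bar> * (norm z / 2) powr a"
      using h a r z by (intro mult_left_mono powr_mono2') auto
    also have "(norm z / 2) powr a = (1/2) powr a * norm z powr a"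
      using powr_mult[of "1/2" "norm z" a] by simp
    finally show ?thesis by (simp add: mult_ac)
  qed
  then show thesis by (rule that)
qed

lemma integrable_kernel:
  assumes k: "admissible k" and u: "norm u < r"
  shows "integrable lborel (\<lambda>z. k (z - u) *\<^sub>R g z)"
proof -
  obtain C where C: "\<And>z. 2 * r \<le> norm z \<Longrightarrow> \<bar>k (z - u)\<bar> \<le> C * norm z powr a"
    using admissible_shift_bound[OF k] u by metis
  note [measurable] = admissible_measurable[OF k]
  show ?thesis
  proof (rule Bochner_Integration.integrable_bound)
    show "integrable lborel (\<lambda>z. C *\<^sub>R (norm z powr a *\<^sub>R g z))"
      by (intro integrable_scaleR_right g_integrable)
    show "AE z in lborel. norm (k (z - u) *\<^sub>R g z) \<le> norm (C *\<^sub>R (norm z powr a *\<^sub>R g z))"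
    proof (rule AE_I2)
      fix z
      show "norm (k (z - u) *\<^sub>R g z) \<le> norm (C *\<^sub>R (norm z powr a *\<^sub>R g z))"
      proof (cases "norm z < 2 * r")
        case False
        then have "\<bar>k (z - u)\<bar> \<le> \<bar>C * norm z powr a\<bar>" using C[of z] by linarith
        then show ?thesis by (simp add: abs_mult mult_right_mono flip: mult.assoc)
      qed (simp add: g_zero)
    qed
  qed measurable
qed

lemma admissible_scale: "admissible k \<Longrightarrow> admissible (\<lambda>z. c * k z)"
proof -
  assume k: "admissible k"
  then obtain C where C: "\<And>z. r \<le> norm z \<Longrightarrow> \<bar>k z\<bar> \<le> C * norm z powr a"
    unfolding admissible_def by blast
  have "\<bar>c * k z\<bar> \<le> (\<bar>c\<bar> * C) * norm z powr a" if "r \<le> norm z" for z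
    using mult_left_mono[OF C[OF that], of "\<bar>c\<bar>"] by (simp add: abs_mult mult_ac)
  then show ?thesis
    using admissible_measurable[OF k] unfolding admissible_def by auto
qed

lemma admissible_add:
  assumes k: "admissible k" and l: "admissible l"
  shows "admissible (\<lambda>z. k z + l z)"
proof -
  obtain C D where C: "\<And>z. r \<le> norm z \<Longrightarrow> \<bar>k z\<bar> \<le> C * norm z powr a"
    and D: "\<And>z. r \<le> norm z \<Longrightarrow> \<bar>l z\<bar> \<le> D * norm z powr a"
    using k l unfolding admissible_def by blast
  have "\<bar>k z + l z\<bar> \<le> (C + D) * norm z powr a" if "r \<le> norm z" for z
    using C[OF that] D[OF that] by (simp add: distrib_right)
  then show ?thesis
    using admissible_measurable[OF k] admissible_measurable[OF l] unfolding admissible_def by auto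
qed

lemma annihilates_scale: "annihilates k \<Longrightarrow> annihilates (\<lambda>z. c * k z)"
  by (simp add: annihilates_def flip: scaleR_scaleR)

lemma annihilates_add:
  assumes "admissible k" "admissible l" "annihilates k" "annihilates l"
  shows "annihilates (\<lambda>z. k z + l z)"
  using assms integrable_kernel unfolding annihilates_def by (simp add: scaleR_add_left)

lemma annihilates_sum:
  assumes "finite I" "\<And>i. i \<in> I \<Longrightarrow> admissible (k i)" "\<And>i. i \<in> I \<Longrightarrow> annihilates (k i)"
  shows "annihilates (\<lambda>z. \<Sum>i\<in>I. k i z)"
  using assms integrable_kernel unfolding annihilates_def
  by (simp add: scaleR_sum_left Bochner_Integration.integral_sum)

text \<open>
  Differentiation with respect to \<open>u\<close> under the integral sign: difference quotients of the kernel annihilate \<open>g\<close>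
  because \<open>u\<close> may be moved a little, and by the mean value theorem they are dominated by the bound for the
  derivative.
\<close>

lemma annihilates_derivative:
  assumes k: "admissible k" and k': "admissible k'"
    and deriv: "\<And>z. z \<noteq> 0 \<Longrightarrow> ((\<lambda>t. k (z + t *\<^sub>R w)) has_real_derivative k' z) (at 0)"
    and ann: "annihilates k"
  shows "annihilates k'"
  unfolding annihilates_def
proof (intro allI impI)
  fix u :: 'a assume u: "norm u < r"
  obtain C where C: "\<And>z v. norm v < r \<Longrightarrow> 2 * r \<le> norm z \<Longrightarrow> \<bar>k' (z - v)\<bar> \<le> C * norm z powr a"
    using admissible_shift_bound[OF k'] by metis
  \<comment> \<open>For steps up to this length, \<open>u\<close> stays in the ball of radius \<open>r\<close>.\<close>
  define \<delta> where "\<delta> = (r - norm u) / (norm w + 1)"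
  have \<delta>: "\<delta> > 0" using u by (simp add: \<delta>_def add_nonneg_pos)
  have near: "norm (u - t *\<^sub>R w) < r" if "0 \<le> t" "t \<le> \<delta>" for t
  proof -
    have "norm (u - t *\<^sub>R w) \<le> norm u + t * norm w"
      using norm_triangle_ineq4[of u "t *\<^sub>R w"] that by simp
    also have "\<dots> \<le> norm u + \<delta> * norm w"
      using that by (simp add: mult_right_mono)
    also have "\<dots> < norm u + \<delta> * (norm w + 1)"
      using \<delta> by simp
    also have "\<dots> = r"
      by (simp add: \<delta>_def add_nonneg_eq_0_iff)
    finally show ?thesis .
  qed
  define t where "t i = \<delta> / real (Suc i)" for i
  have t: "0 < t i" "t i \<le> \<delta>" for i
    using \<delta> by (auto simp: t_def field_simps)
  have t_nz: "t i \<noteq> 0" for i using t(1)[of i] by simp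
  have t0: "t \<longlonglongrightarrow> 0"
    unfolding t_def by (rule LIMSEQ_Suc[OF lim_const_over_n])
  define q where "q i z = (k (z - u + t i *\<^sub>R w) - k (z - u)) / t i" for i z
  note [measurable] = admissible_measurable[OF k] admissible_measurable[OF k']
  have shift: "z - u + s *\<^sub>R w = z - (u - s *\<^sub>R w)" for z s by simp
  have q0: "(LINT z|lborel. q i z *\<^sub>R g z) = 0" for i
  proof -
    have n: "norm (u - t i *\<^sub>R w) < r" using near t by (simp add: less_imp_le)
    have "q i z *\<^sub>R g z = (1 / t i) *\<^sub>R (k (z - (u - t i *\<^sub>R w)) *\<^sub>R g z - k (z - u) *\<^sub>R g z)" for z
      unfolding q_def shift
      by (simp only: diff_divide_distrib scaleR_diff_left scaleR_diff_right scaleR_scaleR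
          times_divide_eq_left mult_1_left)
    then show ?thesis
      using integrable_kernel[OF k n] integrable_kernel[OF k u] ann n u
      unfolding annihilates_def by simp
  qed
  have "(\<lambda>i. LINT z|lborel. q i z *\<^sub>R g z) \<longlonglongrightarrow> (LINT z|lborel. k' (z - u) *\<^sub>R g z)"
  proof (rule integral_dominated_convergence)
    show "integrable lborel (\<lambda>z. norm (C *\<^sub>R (norm z powr a *\<^sub>R g z)))"
      by (intro integrable_norm integrable_scaleR_right g_integrable)
    show "AE z in lborel. (\<lambda>i. q i z *\<^sub>R g z) \<longlonglongrightarrow> k' (z - u) *\<^sub>R g z"
    proof (rule AE_I2)
      fix z
      show "(\<lambda>i. q i z *\<^sub>R g z) \<longlonglongrightarrow> k' (z - u) *\<^sub>R g z"
      proof (cases "norm z < 2 * r")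
        case False
        then have "z - u \<noteq> 0" using u r by auto
        from deriv[OF this] have
          "((\<lambda>h. (k (z - u + h *\<^sub>R w) - k (z - u)) / h) \<longlongrightarrow> k' (z - u)) (at 0)"
          by (simp add: DERIV_def)
        moreover have "filterlim t (at 0) sequentially"
          unfolding filterlim_at using t0 t_nz by simp
        ultimately have "(\<lambda>i. q i z) \<longlonglongrightarrow> k' (z - u)"
          unfolding q_def by (rule filterlim_compose)
        then show ?thesis by (intro tendsto_scaleR tendsto_const)
      qed (simp add: g_zero)
    qed
    show "AE z in lborel. norm (q i z *\<^sub>R g z) \<le> norm (C *\<^sub>R (norm z powr a *\<^sub>R g z))" for i
    proof (rule AE_I2)
      fix z
      show "norm (q i z *\<^sub>R g z) \<le> norm (C *\<^sub>R (norm z powr a *\<^sub>R g z))"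
      proof (cases "norm z < 2 * r")
        case False
        have "((\<lambda>s. k (z - u + s *\<^sub>R w)) has_real_derivative k' (z - u + s *\<^sub>R w)) (at s)"
          if "0 \<le> s" "s \<le> t i" for s
        proof -
          have "z - u + s *\<^sub>R w \<noteq> 0"
            using near[of s] t[of i] that False r unfolding shift by auto
          from deriv[OF this] show ?thesis
            using DERIV_shift[of "\<lambda>s. k (z - u + s *\<^sub>R w)" _ 0 s]
            by (simp add: algebra_simps)
        qed
        from MVT2[OF t(1) this] obtain s where s: "0 < s" "s < t i"
          and eq: "k (z - u + t i *\<^sub>R w) - k (z - u) = t i * k' (z - u + s *\<^sub>R w)"
          by auto
        have "\<bar>q i z\<bar> = \<bar>k' (z - (u - s *\<^sub>R w))\<bar>"
          using eq t(1)[of i] by (simp add: q_def shift)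
        also have "\<dots> \<le> C * norm z powr a"
          using s t[of i] False by (intro C near) auto
        finally have "\<bar>q i z\<bar> \<le> \<bar>C * norm z powr a\<bar>" by linarith
        then show ?thesis by (simp add: abs_mult mult_right_mono flip: mult.assoc)
      qed (simp add: g_zero)
    qed
  qed (unfold q_def, measurable)
  then show "(LINT z|lborel. k' (z - u) *\<^sub>R g z) = 0"
    unfolding q0 by (simp add: LIMSEQ_const_iff)
qed

text \<open>
  The kernel is homogeneous of degree \<open>N + b\<close>.
\<close>

lemma admissible_riesz_kernel:
  assumes "real N + b \<le> a"
  shows "admissible (riesz_kernel N w b)"
proof -
  have "\<bar>riesz_kernel N w b z\<bar> \<le> (norm w ^ N * r powr (real N + b - a)) * norm z powr a"
    if z: "r \<le> norm z" for z
  proof -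
    have z0: "norm z > 0" using z r by linarith
    have "\<bar>riesz_kernel N w b z\<bar> = \<bar>z \<bullet> w\<bar> ^ N * norm z powr b"
      by (simp add: riesz_kernel_def abs_mult power_abs)
    also have "\<dots> \<le> (norm z * norm w) ^ N * norm z powr b"
      using Cauchy_Schwarz_ineq2[of z w] by (intro mult_right_mono power_mono) auto
    also have "\<dots> = norm w ^ N * (norm z powr (real N + b - a) * norm z powr a)"
      using z0 by (simp add: power_mult_distrib powr_realpow[symmetric] powr_add[symmetric])
    also have "\<dots> \<le> norm w ^ N * (r powr (real N + b - a) * norm z powr a)"
      using z r assms by (intro mult_left_mono mult_right_mono powr_mono2') auto
    finally show ?thesis by (simp add: mult_ac)
  qed
  then show ?thesis unfolding admissible_def by auto
qed

lemma annihilates_riesz_kernel_derivative: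
  assumes b: "real N + b \<le> a" and ann: "annihilates (riesz_kernel N w b)"
  shows "annihilates (\<lambda>z. real N * (w \<bullet> w) * riesz_kernel (N - 1) w b z + b * riesz_kernel (Suc N) w (b - 2) z)"
proof (rule annihilates_derivative[where k = "riesz_kernel N w b" and w = w])
  show "admissible (\<lambda>z. real N * (w \<bullet> w) * riesz_kernel (N - 1) w b z + b * riesz_kernel (Suc N) w (b - 2) z)"
    using b by (intro admissible_add admissible_scale admissible_riesz_kernel) auto
qed (use assms DERIV_riesz_kernel[of _ N w b] admissible_riesz_kernel in auto)

end

locale vanishing_riesz_potential = supported_off_ball +
  assumes exponent: "\<And>m :: nat. a + real DIM('a) \<noteq> 2 * real (Suc m)"
    and potential: "\<And>u. norm u < r \<Longrightarrow> (LINT z|lborel. norm (z - u) powr a *\<^sub>R g z) = 0"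
begin

text \<open>
  The Laplacian of \<open>norm z powr b\<close> is \<open>b * (n + b - 2) * norm z powr (b - 2)\<close>, where \<open>n\<close> is the dimension. For \<open>b = a - 2 m\<close> the
  factor is not zero: \<open>b < 0\<close>, and the rest is \<open>exponent\<close>. This is where potentials of even integer order are excluded;
  they are inverted by a power of the Laplacian, a local operator, and have no unique continuation.
\<close>

lemma annihilates_powr: "annihilates (\<lambda>z. norm z powr (a - 2 * real m))"
proof (induction m)
  case 0
  then show ?case using potential by (simp add: annihilates_def)
next
  case (Suc m)
  define b where "b = a - 2 * real m"
  have b: "b < 0" "b \<le> a" using a by (auto simp: b_def)
  have "annihilates (\<lambda>z. (w \<bullet> w) * riesz_kernel 0 w (b - 2) z + (b - 2) * riesz_kernel 2 w (b - 4) z)" for w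
  proof -
    have "annihilates (riesz_kernel 0 w b)"
      using Suc unfolding b_def by (simp add: riesz_kernel_0[abs_def])
    then have "annihilates (\<lambda>z. b * riesz_kernel 1 w (b - 2) z)"
      using annihilates_riesz_kernel_derivative[of 0 b w] b by simp
    then have "annihilates (\<lambda>z. (1 / b) * (b * riesz_kernel 1 w (b - 2) z))"
      by (rule annihilates_scale)
    then have "annihilates (riesz_kernel 1 w (b - 2))"
      using b by simp
    then show ?thesis
      using annihilates_riesz_kernel_derivative[of 1 "b - 2" w] b by (simp add: numeral_2_eq_2)
  qed
  moreover have "admissible (\<lambda>z. (w \<bullet> w) * riesz_kernel 0 w (b - 2) z + (b - 2) * riesz_kernel 2 w (b - 4) z)" for w
    using b by (intro admissible_add admissible_scale admissible_riesz_kernel) auto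
  ultimately have "annihilates (\<lambda>z. \<Sum>w\<in>Basis. (w \<bullet> w) * riesz_kernel 0 w (b - 2) z + (b - 2) * riesz_kernel 2 w (b - 4) z)"
    by (intro annihilates_sum finite_Basis)
  moreover have "(\<Sum>w\<in>Basis. (w \<bullet> w) * riesz_kernel 0 w (b - 2) z + (b - 2) * riesz_kernel 2 w (b - 4) z) =
      (real DIM('a) + b - 2) * norm z powr (b - 2)" for z :: 'a
  proof -
    have "norm z powr (b - 2) = (norm z)\<^sup>2 * norm z powr (b - 4)"
    proof (cases "z = 0")
      case False
      have "norm z powr (b - 2) = norm z powr 2 * norm z powr (b - 4)"
        unfolding powr_add[symmetric] by simp
      then show ?thesis using False by simp
    qed simp
    moreover have sq: "(norm z)\<^sup>2 = (\<Sum>w\<in>Basis. (z \<bullet> w)\<^sup>2)"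
      by (subst power2_norm_eq_inner, subst euclidean_inner) (simp add: power2_eq_square)
    moreover have "(\<Sum>w\<in>Basis. (w \<bullet> w) * riesz_kernel 0 w (b - 2) z + (b - 2) * riesz_kernel 2 w (b - 4) z) =
        (\<Sum>w\<in>(Basis :: 'a set). norm z powr (b - 2) + ((b - 2) * norm z powr (b - 4)) * (z \<bullet> w)\<^sup>2)"
      by (intro sum.cong) (auto simp: riesz_kernel_def)
    moreover have "\<dots> = real DIM('a) * norm z powr (b - 2) + ((b - 2) * norm z powr (b - 4)) * (norm z)\<^sup>2"
      unfolding sum.distrib sum_distrib_left[symmetric] sq by simp
    ultimately show ?thesis
      by (simp add: algebra_simps)
  qed
  ultimately have "annihilates (\<lambda>z. (real DIM('a) + b - 2) * norm z powr (b - 2))"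
    by simp
  then have "annihilates (\<lambda>z. (1 / (real DIM('a) + b - 2)) * ((real DIM('a) + b - 2) * norm z powr (b - 2)))"
    by (rule annihilates_scale)
  moreover have "real DIM('a) + b - 2 \<noteq> 0"
    using exponent[of m] by (auto simp: b_def)
  ultimately have "annihilates (\<lambda>z. norm z powr (b - 2))"
    by simp
  then show ?case by (simp add: b_def algebra_simps)
qed

text \<open>
  By \<open>DERIV_riesz_kernel\<close>, the kernel with exponent \<open>N + 1\<close> is a combination of a derivative of the kernel with exponent \<open>N\<close> and of
  the kernel with exponent \<open>N - 1\<close>. The coefficient \<open>b\<close> by which one divides is negative.
\<close>

lemma annihilates_riesz_kernel:
  "N \<le> m \<Longrightarrow> annihilates (riesz_kernel N w (a - 2 * real m))"
proof (induction N arbitrary: m rule: less_induct)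
  case (less N)
  show ?case
  proof (cases N)
    case 0
    then show ?thesis using annihilates_powr by (simp add: riesz_kernel_0[abs_def])
  next
    case (Suc n)
    with less.prems obtain l where m: "m = Suc l" and l: "n \<le> l"
      by (cases m) auto
    define b where "b = a - 2 * real l"
    have b: "b < 0" "real n + b \<le> a" "real (n - 1) + b \<le> a" "real (Suc n) + (b - 2) \<le> a"
      using a l by (auto simp: b_def)
    have "annihilates (riesz_kernel n w b)" "annihilates (riesz_kernel (n - 1) w b)"
      unfolding b_def using l Suc by (auto intro!: less.IH)
    then have "annihilates (\<lambda>z. (real n * (w \<bullet> w) * riesz_kernel (n - 1) w b z + b * riesz_kernel (Suc n) w (b - 2) z) +
        - (real n * (w \<bullet> w)) * riesz_kernel (n - 1) w b z)"
      using b by (intro annihilates_add annihilates_riesz_kernel_derivative annihilates_scale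
          admissible_add admissible_scale admissible_riesz_kernel)
    then have "annihilates (\<lambda>z. b * riesz_kernel (Suc n) w (b - 2) z)"
      by simp
    then have "annihilates (\<lambda>z. (1 / b) * (b * riesz_kernel (Suc n) w (b - 2) z))"
      by (rule annihilates_scale)
    then have "annihilates (riesz_kernel (Suc n) w (b - 2))"
      using b by simp
    moreover have "b - 2 = a - 2 * real m"
      by (simp add: b_def m)
    ultimately show ?thesis
      by (simp add: Suc)
  qed
qed

text \<open>
  In the coordinate \<open>y = inversion z\<close> the kernel \<open>riesz_kernel N w (a - 2 N)\<close> is \<open>norm z powr a\<close> times \<open>(y \<bullet> w) ^ N\<close>. So the
  complex measure with density \<open>norm z powr a *\<^sub>R g z\<close> has vanishing moments in \<open>y\<close>, and \<open>y\<close> is bounded on the support of \<open>g\<close>.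
\<close>

theorem AE_zero: "AE z in lborel. g z = 0"
proof -
  interpret vanishing_moments lborel "\<lambda>z. norm z powr a *\<^sub>R g z" inversion "1 / (2 * r)"
  proof
    show "integrable lborel (\<lambda>z. norm z powr a *\<^sub>R g z)" by (rule g_integrable)
    show "norm (inversion z) \<le> 1 / (2 * r)" if "norm z powr a *\<^sub>R g z \<noteq> 0" for z
    proof -
      have "\<not> norm z < 2 * r" using that g_zero by auto
      then show ?thesis using r by (simp add: norm_inversion frac_le)
    qed
    show "(LINT z|lborel. (inversion z \<bullet> w) ^ N *\<^sub>R norm z powr a *\<^sub>R g z) = 0" for w N
    proof -
      have "(inversion z \<bullet> w) ^ N * norm z powr a = riesz_kernel N w (a - 2 * real N) z" for z
      proof (cases "z = 0")
        case False
        have "norm z powr (a - 2 * real N) = norm z powr a / norm z powr real (2 * N)"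
          by (simp only: powr_diff of_nat_mult of_nat_numeral)
        also have "norm z powr real (2 * N) = ((norm z)\<^sup>2) ^ N"
          using False by (simp only: powr_realpow power_mult zero_less_norm_iff not_False_eq_True)
        finally have "norm z powr (a - 2 * real N) = norm z powr a / ((norm z)\<^sup>2) ^ N" .
        then show ?thesis
          by (simp add: riesz_kernel_def inversion_def power_mult_distrib power_inverse field_simps)
      qed (simp add: riesz_kernel_def)
      moreover have "(LINT z|lborel. riesz_kernel N w (a - 2 * real N) z *\<^sub>R g z) = 0"
        using annihilates_riesz_kernel[of N N w] r unfolding annihilates_def by (auto dest!: spec[of _ "0 :: 'a"])
      ultimately show ?thesis by simp
    qed
  qed simp
  have "AE z in lborel. norm z powr a *\<^sub>R g z = 0"
    by (rule AE_zero_if_left_inverse[of inversion])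
      (simp_all add: inversion_inversion lborel.sigma_finite_measure_axioms)
  then show ?thesis
    by eventually_elim (use r g_zero[of 0] in auto)
qed

end

section \<open>Unique continuation for the cone transform\<close>

lemma lborel_translation:
  fixes F :: "'a::euclidean_space \<Rightarrow> 'b::{banach, second_countable_topology}"
  assumes [measurable]: "F \<in> borel_measurable borel"
  shows "integrable lborel (\<lambda>x. F (c + x)) \<longleftrightarrow> integrable lborel F"
    and "(LINT x|lborel. F (c + x)) = (LINT x|lborel. F x)"
proof -
  have "integrable (distr lborel borel ((+) c)) F \<longleftrightarrow> integrable lborel (\<lambda>x. F (c + x))"
    by (rule integrable_distr_eq) measurable
  then show "integrable lborel (\<lambda>x. F (c + x)) \<longleftrightarrow> integrable lborel F"
    by (simp only: lborel_distr_plus)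
  have "(LINT x|distr lborel borel ((+) c). F x) = (LINT x|lborel. F (c + x))"
    by (rule integral_distr) measurable
  then show "(LINT x|lborel. F (c + x)) = (LINT x|lborel. F x)"
    by (simp only: lborel_distr_plus)
qed

text \<open>
  The data at the vertices \<open>u\<close> are used only near one point \<open>u\<^sub>0\<close> of \<open>U\<close>, which is moved to the origin. The exponent of the
  Lebesgue space is at least 1 because \<open>4 * s\<close> is at most the dimension \<open>n\<close>, and the kernel \<open>norm z powr (2 * s - n)\<close> is in the dual
  Lebesgue space off a ball.
\<close>

theorem cone_transform_unique_continuation:
  fixes f :: "'a::euclidean_space \<Rightarrow> complex" and s :: real
  assumes dim: "DIM('a) \<ge> 2"
    and s: "0 < s" "s \<le> real DIM('a) / 4" "s \<notin> \<int>"
    and f: "in_Lp (2 * real DIM('a) / (real DIM('a) + 4 * s)) f"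
    and \<beta>: "norm \<beta> = 1" and U: "open U" "u\<^sub>0 \<in> U"
    and fU: "AE x in lebesgue. x \<in> U \<longrightarrow> f x = 0"
    and cones: "\<And>u \<psi>. u \<in> U \<Longrightarrow> 0 < \<psi> \<Longrightarrow> \<psi> < pi \<Longrightarrow> cone_transform (2 * s - 1) f u \<beta> \<psi> = 0"
  shows "AE x in lebesgue. f x = 0"
proof -
  let ?n = "real DIM('a)"
  define p where "p = 2 * ?n / (?n + 4 * s)"
  define a where "a = 2 * s - ?n"
  have n: "?n \<ge> 2" using dim by simp
  have a: "a < 0" using s n by (simp add: a_def)
  have p: "p \<ge> 1" using s n by (simp add: p_def field_simps)
  have "2 * s * p < ?n"
    using s n by (simp add: p_def field_simps)
  then have exponents: "?n * (p - 1) < - a * p"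
    by (simp add: a_def algebra_simps)
  have fm: "f \<in> borel_measurable lebesgue" and fp: "integrable lebesgue (\<lambda>x. norm (f x) powr p)"
    using f by (auto simp: in_Lp_def p_def)
  obtain R where R: "R > 0" "ball u\<^sub>0 R \<subseteq> U"
    using U openE by blast
  define r where "r = R / 2"
  have r: "r > 0" and ball: "\<And>x. norm (x - u\<^sub>0) < 2 * r \<Longrightarrow> x \<in> U"
    using R by (auto simp: r_def dist_norm norm_minus_commute)

  obtain g\<^sub>0 where [measurable]: "g\<^sub>0 \<in> borel_measurable lborel" and fg\<^sub>0: "AE x in lborel. f x = g\<^sub>0 x"
    using completion_ex_borel_measurable_complex[OF fm] .
  \<comment> \<open>A Borel representative of \<open>f\<close> that vanishes on the ball everywhere.\<close>
  define g where "g x = (if norm (x - u\<^sub>0) < 2 * r then 0 else g\<^sub>0 x)" for x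
  have gm[measurable]: "g \<in> borel_measurable borel"
    unfolding g_def by measurable
  have fg: "AE x in lborel. f x = g x"
    using fg\<^sub>0 fU unfolding AE_completion_iff
    by eventually_elim (auto simp: g_def ball)
  have "integrable lebesgue (\<lambda>x. norm (g x) powr p)"
  proof (rule integrable_cong_AE_imp[OF fp])
    show "AE x in lebesgue. norm (f x) powr p = norm (g x) powr p"
      using AE_completion[OF fg] by eventually_elim simp
  qed (intro measurable_completion, measurable)
  then have gp: "integrable lborel (\<lambda>x. norm (g x) powr p)"
    by (subst (asm) integrable_completion) measurable

  \<comment> \<open>The representative in coordinates centred at \<open>u\<^sub>0\<close>.\<close>
  define h where "h z = g (u\<^sub>0 + z)" for z
  have hm[measurable]: "h \<in> borel_measurable borel"
    unfolding h_def by measurable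
  have h0: "\<And>z. norm z < 2 * r \<Longrightarrow> h z = 0"
    by (simp add: h_def g_def)
  have "integrable lborel (\<lambda>z. norm (h z) powr p)"
    using gp unfolding h_def by (subst lborel_translation(1)[where F = "\<lambda>x. norm (g x) powr p"]) measurable
  then have hi: "integrable lborel (\<lambda>z. norm z powr a *\<^sub>R h z)"
    using r h0 p a exponents by (intro integrable_powr_mult_outside_ball[of h p a "2 * r"]) auto
  interpret supported_off_ball h r a
    by unfold_locales (use r a h0 hi in auto)
  interpret vanishing_riesz_potential h r a
  proof
    show "a + ?n \<noteq> 2 * real (Suc m)" for m
    proof
      assume "a + ?n = 2 * real (Suc m)"
      then have "s = real (Suc m)" by (simp add: a_def)
      then show False using s(3) Ints_of_nat[of "Suc m", where 'a = real] by metis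
    qed
    fix u :: 'a assume u: "norm u < r"
    let ?F = "\<lambda>x. norm (x - (u\<^sub>0 + u)) powr (2 * s - 1 + 1 - ?n) *\<^sub>R g x"
    have hF: "norm (z - u) powr a *\<^sub>R h z = ?F (u\<^sub>0 + z)" for z
      by (simp add: h_def a_def)
    have "admissible (\<lambda>z. norm z powr a)"
      unfolding admissible_def by (intro conjI exI[of _ 1]) auto
    from integrable_kernel[OF this u] have "integrable lborel ?F"
      unfolding hF by (subst (asm) lborel_translation(1)[where F = ?F]) measurable
    moreover have "u\<^sub>0 + u \<in> U"
      using u r by (intro ball) simp
    ultimately have "(LINT x|lborel. ?F x) = 0"
      by (intro riesz_potential_eq_0_if_cone_transform_eq_0[OF gm fg dim \<beta>] cones)
    then show "(LINT z|lborel. norm (z - u) powr a *\<^sub>R h z) = 0"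
      unfolding hF by (subst lborel_translation(2)[where F = ?F]) measurable
  qed
  have "AE z in distr lborel borel ((+) u\<^sub>0). g z = 0"
    using AE_zero by (subst AE_distr_iff) (auto simp: h_def)
  then have "AE x in lborel. g x = 0"
    by (simp only: lborel_distr_plus)
  with fg have "AE x in lborel. f x = 0"
    by eventually_elim simp
  then show ?thesis
    by (rule AE_completion)
qed

theorem corollary5p14:
  fixes f :: "real ^ 'n \<Rightarrow> complex" and s :: real
  assumes "CARD('n) \<ge> 2"
    and "0 < s" and "s \<le> real CARD('n) / 4" and "s \<notin> \<int>"
    and "in_Lp (2 * real CARD('n) / (real CARD('n) + 4 * s)) f"
    and "\<exists>\<beta> \<in> sphere 0 1. \<exists>U. open U \<and> U \<noteq> {} \<and>
           (AE x in lebesgue. x \<in> U \<longrightarrow> f x = 0) \<and>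
           (\<forall>u\<in>U. \<forall>\<psi>\<in>{0<..<pi}. cone_transform (2 * s - 1) f u \<beta> \<psi> = 0)"
  shows "AE x in lebesgue. f x = 0"
proof -
  obtain \<beta> U u where "norm \<beta> = 1" "open U" "u \<in> U" "AE x in lebesgue. x \<in> U \<longrightarrow> f x = 0"
    and cones: "\<forall>u\<in>U. \<forall>\<psi>\<in>{0<..<pi}. cone_transform (2 * s - 1) f u \<beta> \<psi> = 0"
    using assms(6) by auto
  moreover have "cone_transform (2 * s - 1) f u \<beta> \<psi> = 0" if "u \<in> U" "0 < \<psi>" "\<psi> < pi" for u \<psi>
    using cones that by simp
  ultimately show ?thesis
    using assms(1-5) by (intro cone_transform_unique_continuation[of s f \<beta> U u]) auto
qed

end
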